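(* Let $d\ge1$ and let $\Phi:[-1,1]\to\mathbb{R}$ be a piecewise polynomial of degree at most $r$ with knots $-1=s_0<s_1<\cdots<s_\ell=1$ such that $|\Phi(s)-\Phi(s')|\le|s-s'|$ for all $s,s'\in[-1,1]$. Let $m_r$ denote the dimension of the space of all spherical polynomials of degree at most $r$ on $\mathbb{S}^d$. Let $g\in L^\infty(\mathbb{S}^d)$ with $\|g\|_\infty\le1$. Then for each integer $N\ge20$ there exist points $\xi_1,\dots,\xi_{2(m_r+2)N}\in\mathbb{S}^d$ and real numbers $\lambda_1,\dots,\lambda_{2(m_r+2)N}$ such that $$\max_{x\in\mathbb{S}^d}\left|\int_{\mathbb{S}^d}\Phi(x\cdot y)g(y)\,d\mu_d(y)-\sum_{j=1}^{2(m_r+2)N}\lambda_j\Phi(x\cdot\xi_j)\right|\le7\cdot10^6\,\sqrt{\ell}\,d^{\frac34}\,N^{-\frac12-\frac{3}{2d}}\sqrt{\log N}.$$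
   Context: $\mathbb{S}^d$ is the unit sphere of $\mathbb{R}^{d+1}$ and $\mu_d$ is its normalized (total mass one) surface Lebesgue measure; $x\cdot y$ is the Euclidean inner product. Spherical polynomials of degree at most $r$ on $\mathbb{S}^d$ are the restrictions to $\mathbb{S}^d$ of real polynomials in $d+1$ variables of total degree at most $r$. Piecewise polynomial of degree at most $r$ with the given knots means that on each $[s_{i-1},s_i]$ the function coincides with an algebraic polynomial of degree at most $r$. *)

theory Defs
  imports
    "HOL-Probability.Probability"
    "HOL-Probability.Essential_Supremum"
    "HOL-Computational_Algebra.Polynomial"
    "HOL-Library.Function_Algebras"
begin

text \<open>
  The sphere of dimension \<open>d\<close> is \<open>sphere 0 1 :: (real ^ 'n) set\<close> with \<open>CARD('n) = d + 1\<close>.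

  Its normalized surface Lebesgue measure is obtained by polar coordinates: a Borel set \<open>A\<close> of
  unit vectors has measure \<open>vol {t *\<^sub>R a | t a. 0 < t \<le> 1 \<and> a \<in> A} / vol (cball 0 1)\<close>, i.e. the
  measure is the image of the uniform distribution on the unit ball under \<open>sgn x = x /\<^sub>R norm x\<close>.
  (\<open>sgn 0 = 0\<close> is not a unit vector, but the origin is a null set.)
  The completion makes all Lebesgue measurable functions on the sphere measurable.
\<close>

definition sphere_borel_measure :: "(real ^ 'n) measure" where
  "sphere_borel_measure =
     restrict_space (distr (uniform_measure lborel (cball 0 1)) borel sgn) (sphere 0 1)"

definition sphere_measure :: "(real ^ 'n) measure" where
  "sphere_measure = completion sphere_borel_measure"

lemma emeasure_lborel_cball_01:
  "emeasure lborel (cball 0 1 :: (real ^ 'n) set) \<noteq> 0"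
  "emeasure lborel (cball 0 1 :: (real ^ 'n) set) \<noteq> \<infinity>"
proof -
  have "measure lborel (cball 0 1 :: (real ^ 'n) set) > 0"
    by (rule content_cball_pos) simp
  then show "emeasure lborel (cball 0 1 :: (real ^ 'n) set) \<noteq> 0"
    by (auto simp: measure_def)
  show "emeasure lborel (cball 0 1 :: (real ^ 'n) set) \<noteq> \<infinity>"
    using emeasure_lborel_cball_finite[of "0 :: real ^ 'n" 1] by (simp add: less_top)
qed

lemma sgn_measurable [measurable]:
  "(sgn :: real ^ 'n \<Rightarrow> real ^ 'n) \<in> borel_measurable borel"
  unfolding sgn_div_norm[abs_def] by measurable

lemma space_sphere_borel_measure: "space (sphere_borel_measure :: (real ^ 'n) measure) = sphere 0 1"
  by (simp add: sphere_borel_measure_def space_restrict_space)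

lemma sets_sphere_borel_measure:
  "sets (sphere_borel_measure :: (real ^ 'n) measure) = sets (restrict_space borel (sphere 0 1))"
  unfolding sphere_borel_measure_def by (intro sets_restrict_space_cong) simp

lemma emeasure_sphere_borel_measure:
  assumes "A \<in> sets borel" "A \<subseteq> sphere (0 :: real ^ 'n) 1"
  shows "emeasure sphere_borel_measure A =
    emeasure lborel {t *\<^sub>R a | t a. 0 < t \<and> t \<le> 1 \<and> a \<in> A} / emeasure lborel (cball (0 :: real ^ 'n) 1)"
proof -
  have eq: "cball 0 1 \<inter> sgn -` A = {t *\<^sub>R a | t a. 0 < t \<and> t \<le> 1 \<and> a \<in> A}" (is "?L = ?R")
  proof (intro equalityI subsetI)
    fix x assume x: "x \<in> ?L"
    then have "norm (sgn x) = 1" using assms(2) by auto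
    then have "x \<noteq> 0" by auto
    then have "x = norm x *\<^sub>R sgn x" by (simp add: sgn_div_norm)
    with x \<open>x \<noteq> 0\<close> show "x \<in> ?R"
      by (intro CollectI exI[of _ "norm x"] exI[of _ "sgn x"]) auto
  next
    fix x assume "x \<in> ?R"
    then obtain t a where "x = t *\<^sub>R a" "0 < t" "t \<le> 1" "a \<in> A" by auto
    moreover from this assms(2) have "norm a = 1" by auto
    ultimately show "x \<in> ?L" by (auto simp: sgn_div_norm)
  qed
  have m: "sgn -` A \<in> sets (borel :: (real ^ 'n) measure)"
    using measurable_sets_borel[OF sgn_measurable assms(1)] by simp
  have "emeasure sphere_borel_measure A
      = emeasure (distr (uniform_measure lborel (cball 0 1)) borel (sgn :: real ^ 'n \<Rightarrow> real ^ 'n)) A"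
    unfolding sphere_borel_measure_def using assms(2) by (intro emeasure_restrict_space) auto
  also have "\<dots> = emeasure (uniform_measure lborel (cball 0 1)) (sgn -` A)"
    using assms(1) by (subst emeasure_distr) (auto simp: measurable_cong_sets[OF sets_uniform_measure refl])
  also have "\<dots> = emeasure lborel (cball 0 1 \<inter> sgn -` A) / emeasure lborel (cball (0 :: real ^ 'n) 1)"
    using m by (intro emeasure_uniform_measure) auto
  finally show ?thesis unfolding eq .
qed

lemma prob_space_sphere_borel_measure: "prob_space (sphere_borel_measure :: (real ^ 'n) measure)"
proof
  have "{t *\<^sub>R a | t a. 0 < t \<and> t \<le> 1 \<and> a \<in> sphere (0 :: real ^ 'n) 1} = cball 0 1 - {0}" (is "?L = ?R")
  proof (intro equalityI subsetI)
    fix x :: "real ^ 'n" assume "x \<in> ?R"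
    then show "x \<in> ?L"
      by (intro CollectI exI[of _ "norm x"] exI[of _ "sgn x"]) (auto simp: norm_sgn sgn_div_norm)
  qed auto
  moreover have "emeasure lborel (cball 0 1 - {0 :: real ^ 'n}) = emeasure lborel (cball (0 :: real ^ 'n) 1)"
    by (intro emeasure_Diff_null_set) auto
  ultimately show "emeasure (sphere_borel_measure :: (real ^ 'n) measure) (space sphere_borel_measure) = 1"
    using emeasure_lborel_cball_01[where 'n = 'n]
    by (simp add: space_sphere_borel_measure emeasure_sphere_borel_measure ennreal_divide_self less_top)
qed

lemma prob_space_sphere_measure: "prob_space (sphere_measure :: (real ^ 'n) measure)"
  unfolding sphere_measure_def by (rule prob_space.prob_space_completion[OF prob_space_sphere_borel_measure])

text \<open>
  Real polynomial functions in \<open>CARD('n)\<close> variables of total degree at most \<open>r\<close>; the sum ranges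
  over the finitely many exponent vectors of the monomials of total degree at most \<open>r\<close>.
\<close>

definition polynomials_deg_le :: "nat \<Rightarrow> (real ^ 'n \<Rightarrow> real) set" where
  "polynomials_deg_le r =
     {(\<lambda>x. \<Sum>k | (\<Sum>i\<in>UNIV. k i) \<le> r. c k * (\<Prod>i\<in>UNIV. x $ i ^ k i)) | c :: ('n \<Rightarrow> nat) \<Rightarrow> real. True}"

lemma finite_exponents: "finite {k :: 'n :: finite \<Rightarrow> nat. (\<Sum>i\<in>UNIV. k i) \<le> r}"
proof (rule finite_subset)
  have "k i \<le> (\<Sum>i\<in>UNIV. k i)" for k :: "'n \<Rightarrow> nat" and i
    by (rule member_le_sum) auto
  then show "{k :: 'n \<Rightarrow> nat. (\<Sum>i\<in>UNIV. k i) \<le> r} \<subseteq> PiE UNIV (\<lambda>_. {..r})"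
    by (auto simp: PiE_UNIV_domain intro: le_trans)
qed (simp add: finite_PiE)

text \<open>
  A real function on the sphere is represented by its extension by \<open>0\<close>, so that distinct elements
  of \<open>spherical_polynomials r\<close> are distinct as functions on the sphere.
\<close>

definition spherical_polynomials :: "nat \<Rightarrow> (real ^ 'n \<Rightarrow> real) set" where
  "spherical_polynomials r =
     (\<lambda>p x. if x \<in> sphere 0 1 then p x else 0) ` polynomials_deg_le r"

definition scale_fun :: "real \<Rightarrow> ('a \<Rightarrow> real) \<Rightarrow> 'a \<Rightarrow> real" where
  "scale_fun c f = (\<lambda>x. c * f x)"

interpretation fun_space: vector_space "scale_fun :: real \<Rightarrow> ('a \<Rightarrow> real) \<Rightarrow> 'a \<Rightarrow> real"
  by standard (auto simp: scale_fun_def fun_eq_iff algebra_simps)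

lemma subspace_spherical_polynomials:
  "fun_space.subspace (spherical_polynomials r :: (real ^ 'n \<Rightarrow> real) set)"
proof (rule fun_space.subspaceI)
  define P where "P c = (\<lambda>x :: real ^ 'n. if x \<in> sphere 0 1 then
    \<Sum>k | (\<Sum>i\<in>UNIV. k i) \<le> r. c k * (\<Prod>i\<in>UNIV. x $ i ^ k i) else 0)" for c :: "('n \<Rightarrow> nat) \<Rightarrow> real"
  have S: "spherical_polynomials r = range P"
    by (auto simp: spherical_polynomials_def polynomials_deg_le_def P_def)
  have "P (\<lambda>_. 0) = 0" by (simp add: P_def fun_eq_iff)
  then show "(0 :: real ^ 'n \<Rightarrow> real) \<in> spherical_polynomials r" unfolding S by (metis rangeI)
  fix f g :: "real ^ 'n \<Rightarrow> real" assume "f \<in> spherical_polynomials r" "g \<in> spherical_polynomials r"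
  then obtain a b where ab: "f = P a" "g = P b" unfolding S by auto
  have "P a + P b = P (\<lambda>k. a k + b k)"
    by (simp add: P_def fun_eq_iff sum.distrib algebra_simps)
  then show "f + g \<in> spherical_polynomials r" unfolding S ab by simp
next
  fix c and f :: "real ^ 'n \<Rightarrow> real" assume "f \<in> spherical_polynomials r"
  then obtain a where a: "f = (\<lambda>x. if x \<in> sphere 0 1 then
    \<Sum>k | (\<Sum>i\<in>UNIV. k i) \<le> r. a k * (\<Prod>i\<in>UNIV. x $ i ^ k i) else 0)"
    by (auto simp: spherical_polynomials_def polynomials_deg_le_def)
  have "scale_fun c f = (\<lambda>x. if x \<in> sphere 0 1 then
    \<Sum>k | (\<Sum>i\<in>UNIV. k i) \<le> r. (c * a k) * (\<Prod>i\<in>UNIV. x $ i ^ k i) else 0)"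
    by (simp add: a scale_fun_def fun_eq_iff sum_distrib_left mult.assoc)
  then show "scale_fun c f \<in> spherical_polynomials r"
    unfolding spherical_polynomials_def polynomials_deg_le_def
    by (intro image_eqI[where x = "\<lambda>x. \<Sum>k | (\<Sum>i\<in>UNIV. k i) \<le> r. (c * a k) * (\<Prod>i\<in>UNIV. x $ i ^ k i)"])
       auto
qed

definition dim_spherical_polynomials :: "'n :: finite itself \<Rightarrow> nat \<Rightarrow> nat" where
  "dim_spherical_polynomials _ r =
     vector_space.dim scale_fun (spherical_polynomials r :: (real ^ 'n \<Rightarrow> real) set)"

definition piecewise_polynomial :: "nat \<Rightarrow> nat \<Rightarrow> (nat \<Rightarrow> real) \<Rightarrow> (real \<Rightarrow> real) \<Rightarrow> bool" where
  "piecewise_polynomial r l s \<Phi> \<longleftrightarrow>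
     (\<forall>i\<in>{1..l}. \<exists>p :: real poly. degree p \<le> r \<and> (\<forall>t\<in>{s (i - 1)..s i}. \<Phi> t = poly p t))"

end

theory Submission
  imports Defs
begin

text \<open>
  Cover the sphere by at most \<open>N/2\<close> cells of diameter \<open>O(N powr (-1/d))\<close>, and replace \<open>g d\<mu>\<close> by a
  finite discrete measure on a fine net. In each cell, the weights (of the positive and of the negative
  part) can be replaced by weights on at most \<open>m\<^sub>r\<close> points without changing the integrals of spherical
  polynomials of degree at most \<open>r\<close>: this is a basic solution of a linear program, and its linear objective
  is still free. As \<open>y \<mapsto> \<Phi> (x \<bullet> y)\<close> is a spherical polynomial on a cell unless the cell meets one of
  the levels \<open>x \<bullet> y = s\<^sub>i\<close>, only the cells near these levels contribute to the error at \<open>x\<close>. They have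
  total measure \<open>O(l sqrt d N powr (-1/d))\<close>, and each contributes at most its diameter times its mass.
  Choosing the objectives by the method of conditional expectations gives an error of Hoeffding type:
  the root of the sum of the squared contributions times the root of \<open>O(d ln N)\<close>, the logarithm of the
  size of a net of test points \<open>x\<close>.
\<close>

subsection \<open>Sparse measures with prescribed moments\<close>

text \<open>The rate has three sources. The pieces that are sparsified carry mass at most
  \<open>2/N\<close> each; \<open>\<Phi> (x \<bullet> y)\<close> oscillates by
  O(\<open>N powr (-1/d)\<close>) on a cell; and the mass that enters the variance is
  O(\<open>l * sqrt d * N powr (-1/d)\<close>). The variance is therefore
  O(\<open>l * sqrt d * N powr (-1 - 3/d)\<close>), and its root times
  \<open>sqrt (d * ln N)\<close> produces the power 3/4 of \<open>d\<close> and the exponent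
  \<open>-1/2 - 3/(2*d)\<close>. The factor \<open>sqrt d\<close> bounds the ratio of the volumes of
  the unit balls of dimensions \<open>d\<close> and \<open>d + 1\<close>. Discretizing first turns
  every measure into a finite weight vector, so that sparsification is finite linear algebra. One
  net supplies both the candidate points and the test points. Exactness on polynomials holds for
  every admissible choice of weights and for all \<open>x\<close> at once, so the free objective can
  be spent entirely on the cells near the levels. Numerical constants must not depend on
  \<open>d\<close>. Covering numbers are therefore estimated as \<open>d + 1\<close> times a
  \<open>d\<close>-th power, and \<open>4 * (d + 1) \<le> 8 ^ d\<close> hides the first factor in
  the base of the second.\<close>

text \<open>Gaussian elimination, one equation at a time: an equation with a nonzero coefficient at
  \<open>q\<close> is solved for \<open>u q\<close>, and substitution leaves one equation and one
  unknown fewer. An equation that vanishes on \<open>T\<close> costs no unknown.\<close>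

lemma underdetermined_system_nontrivial_solution:
  fixes f :: "'b \<Rightarrow> 'a \<Rightarrow> real"
  assumes "finite B" "finite T" "card B < card T"
  shows "\<exists>u. (\<exists>p\<in>T. u p \<noteq> 0) \<and> (\<forall>b\<in>B. (\<Sum>p\<in>T. u p * f b p) = 0)"
  using assms
proof (induction B arbitrary: T f rule: finite_induct)
  case empty
  then obtain p where "p \<in> T" by (metis card.empty less_numeral_extra(3) ex_in_conv)
  then show ?case by (intro exI[of _ "\<lambda>_. 1"]) auto
next
  case (insert b0 B)
  show ?case
  proof (cases "\<forall>p\<in>T. f b0 p = 0")
    case True
    have "card B < card T" using insert by simp
    from insert.IH[OF insert.prems(1) this, of f] obtain u where
      "\<exists>p\<in>T. u p \<noteq> 0" "\<forall>b\<in>B. (\<Sum>p\<in>T. u p * f b p) = 0" by blast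
    with True show ?thesis by (intro exI[of _ u]) auto
  next
    case False
    then obtain q where q: "q \<in> T" "f b0 q \<noteq> 0" by blast
    let ?T = "T - {q}"
    have "card B < card ?T" using insert q by (simp add: card_Diff_singleton)
    moreover have "finite ?T" using insert by simp
    ultimately obtain u where
      u: "\<exists>p\<in>?T. u p \<noteq> 0" "\<forall>b\<in>B. (\<Sum>p\<in>?T. u p * (f b p - f b q * f b0 p / f b0 q)) = 0"
      using insert.IH[of ?T "\<lambda>b p. f b p - f b q * f b0 p / f b0 q"] by blast
    define t where "t = - (\<Sum>p\<in>?T. u p * f b0 p) / f b0 q"
    define u' where "u' = u(q := t)"
    have split: "(\<Sum>p\<in>T. u' p * f b p) = t * f b q + (\<Sum>p\<in>?T. u p * f b p)" for b
      using q insert.prems(1) by (subst sum.remove[of _ q]) (auto simp: u'_def intro!: sum.cong)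
    have "(\<Sum>p\<in>T. u' p * f b p) = 0" if "b \<in> B" for b
    proof -
      have "(\<Sum>p\<in>?T. u p * (f b p - f b q * f b0 p / f b0 q))
          = (\<Sum>p\<in>?T. u p * f b p) - f b q / f b0 q * (\<Sum>p\<in>?T. u p * f b0 p)"
        by (simp add: right_diff_distrib sum_subtractf sum_distrib_left mult_ac)
      then show ?thesis
        unfolding split t_def using u(2)[rule_format, OF that] by (simp add: field_simps)
    qed
    moreover have "(\<Sum>p\<in>T. u' p * f b0 p) = 0"
      unfolding split t_def using q by simp
    moreover have "\<exists>p\<in>T. u' p \<noteq> 0"
      using u(1) unfolding u'_def by auto
    ultimately show ?thesis by blast
  qed
qed

text \<open>
  As in the simplex method: along a nontrivial direction that preserves all moments, taken with
  the sign that does not increase \<open>\<alpha>\<close>, some weight reaches zero.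
\<close>

lemma reduce_support:
  fixes w \<alpha> :: "'a \<Rightarrow> real" and B :: "('a \<Rightarrow> real) set"
  assumes "finite P" "finite B"
    and one: "\<And>u. (\<forall>b\<in>B. (\<Sum>p\<in>P. u p * b p) = 0) \<Longrightarrow> (\<Sum>p\<in>P. u p) = 0"
    and "\<forall>p\<in>P. 0 \<le> w p"
  shows "\<exists>v. (\<forall>p\<in>P. 0 \<le> v p) \<and> (\<forall>p\<in>P. w p = 0 \<longrightarrow> v p = 0)
    \<and> (\<forall>b\<in>B. (\<Sum>p\<in>P. v p * b p) = (\<Sum>p\<in>P. w p * b p))
    \<and> card {p\<in>P. v p \<noteq> 0} \<le> card B \<and> (\<Sum>p\<in>P. v p * \<alpha> p) \<le> (\<Sum>p\<in>P. w p * \<alpha> p)"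
  using assms(4)
proof (induction "card {p\<in>P. w p \<noteq> 0}" arbitrary: w rule: less_induct)
  case less
  let ?T = "{p\<in>P. w p \<noteq> 0}"
  show ?case
  proof (cases "card ?T \<le> card B")
    case True
    with less.prems show ?thesis by (intro exI[of _ w]) auto
  next
    case False
    have finT: "finite ?T" using assms(1) by simp
    obtain u0 where u0: "\<exists>p\<in>?T. u0 p \<noteq> 0" "\<forall>b\<in>B. (\<Sum>p\<in>?T. u0 p * b p) = 0"
      using underdetermined_system_nontrivial_solution[OF assms(2) finT, of "\<lambda>b. b"] False
      by (auto simp: not_le)
    define u1 where "u1 p = (if p \<in> ?T then u0 p else 0)" for p
    have u1: "(\<Sum>p\<in>P. u1 p * b p) = (\<Sum>p\<in>?T. u0 p * b p)" for b
      unfolding u1_def using assms(1) by (intro sum.mono_neutral_cong_right) auto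
    define \<epsilon> :: real where "\<epsilon> = (if (\<Sum>p\<in>P. u1 p * \<alpha> p) \<le> 0 then 1 else -1)"
    define u where "u p = \<epsilon> * u1 p" for p
    have uA: "(\<Sum>p\<in>P. u p * \<alpha> p) \<le> 0"
      unfolding u_def mult.assoc sum_distrib_left[symmetric] by (simp add: \<epsilon>_def)
    have uB: "(\<Sum>p\<in>P. u p * b p) = 0" if "b \<in> B" for b
      unfolding u_def mult.assoc sum_distrib_left[symmetric] u1 using u0(2) that by simp
    have usum: "(\<Sum>p\<in>P. u p) = 0" using one uB by blast
    have uz: "u p = 0" if "w p = 0" for p using that by (simp add: u_def u1_def)
    obtain p0 where p0: "p0 \<in> P" "u p0 \<noteq> 0"
      using u0(1) unfolding u_def u1_def \<epsilon>_def by (auto split: if_splits)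
    define Neg where "Neg = {p\<in>P. u p < 0}"
    have finN: "finite Neg" unfolding Neg_def using assms(1) by simp
    \<comment> \<open>By \<open>one\<close> the direction has total mass zero. Being nonzero, it has
      a negative entry, so moving along it must leave the cone of nonnegative weights.\<close>
    have "Neg \<noteq> {}"
    proof
      assume "Neg = {}"
      then have nn: "\<forall>p\<in>P. 0 \<le> u p" unfolding Neg_def by (auto simp: not_less)
      then have "\<forall>p\<in>P. u p = 0"
        using usum sum_nonneg_eq_0_iff[of P u] assms(1) by simp
      with p0 show False by blast
    qed
    define t where "t = Min ((\<lambda>p. w p / - u p) ` Neg)"
    have "t \<in> (\<lambda>p. w p / - u p) ` Neg"
      unfolding t_def using finN \<open>Neg \<noteq> {}\<close> by (intro Min_in) auto
    then obtain p1 where p1: "p1 \<in> Neg" "t = w p1 / - u p1" by blast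
    have tle: "t \<le> w p / - u p" if "p \<in> Neg" for p
      unfolding t_def using finN that by (intro Min_le) auto
    have t0: "0 \<le> t"
      using p1 less.prems unfolding Neg_def by (auto intro: divide_nonneg_neg)
    define w' where "w' p = w p + t * u p" for p
    have w'0: "0 \<le> w' p" if "p \<in> P" for p
    proof (cases "u p < 0")
      case True
      then have "t \<le> w p / - u p" using tle that unfolding Neg_def by blast
      then show ?thesis using True unfolding w'_def by (simp add: field_simps)
    next
      case False
      then show ?thesis using t0 less.prems that unfolding w'_def by (auto simp: not_less)
    qed
    have w'sum: "(\<Sum>p\<in>P. w' p * f p) = (\<Sum>p\<in>P. w p * f p) + t * (\<Sum>p\<in>P. u p * f p)" for f
      unfolding w'_def by (simp add: algebra_simps sum.distrib sum_distrib_left)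
    have "w' p1 = 0" using p1 unfolding w'_def Neg_def by (auto simp: field_simps)
    moreover have "p1 \<in> ?T" using p1 uz[of p1] unfolding Neg_def by auto
    moreover have "w' p = 0" if "w p = 0" for p using that uz unfolding w'_def by simp
    ultimately have "{p\<in>P. w' p \<noteq> 0} \<subset> ?T" by blast
    then have "card {p\<in>P. w' p \<noteq> 0} < card ?T" using finT by (rule psubset_card_mono[rotated])
    from less.hyps[OF this] w'0 obtain v where v:
      "\<forall>p\<in>P. 0 \<le> v p" "\<forall>p\<in>P. w' p = 0 \<longrightarrow> v p = 0"
      "\<forall>b\<in>B. (\<Sum>p\<in>P. v p * b p) = (\<Sum>p\<in>P. w' p * b p)"
      "card {p\<in>P. v p \<noteq> 0} \<le> card B" "(\<Sum>p\<in>P. v p * \<alpha> p) \<le> (\<Sum>p\<in>P. w' p * \<alpha> p)" by blast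
    have "(\<Sum>p\<in>P. v p * \<alpha> p) \<le> (\<Sum>p\<in>P. w p * \<alpha> p)"
      using v(5) w'sum[of \<alpha>] mult_nonneg_nonpos[OF t0 uA] by linarith
    moreover have "\<forall>p\<in>P. w p = 0 \<longrightarrow> v p = 0"
      using v(2) \<open>\<And>p. w p = 0 \<Longrightarrow> w' p = 0\<close> by blast
    moreover have "\<forall>b\<in>B. (\<Sum>p\<in>P. v p * b p) = (\<Sum>p\<in>P. w p * b p)"
      using v(3) w'sum uB by simp
    ultimately show ?thesis using v(1,4) by blast
  qed
qed

section \<open>Exponential moments and derandomized selection\<close>

text \<open>On [-1, 1] both sides are compared with \<open>1 + x + x\<^sup>2\<close>; for negative
  \<open>x\<close> this uses \<open>(1 + x + x\<^sup>2) * (1 - x) = 1 - x ^ 3\<close>. Outside, the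
  crude bounds \<open>exp x \<le> exp (x\<^sup>2)\<close> for \<open>x > 1\<close> and
  \<open>exp x \<le> 1\<close> for \<open>x < -1\<close> suffice.\<close>

lemma exp_le_add_exp_square: "exp (x :: real) \<le> x + exp (x\<^sup>2)"
proof -
  have sq: "1 + x\<^sup>2 \<le> exp (x\<^sup>2)" by (rule exp_ge_add_one_self)
  consider "x > 1" | "0 \<le> x" "x \<le> 1" | "-1 \<le> x" "x < 0" | "x < -1" by linarith
  then show ?thesis
  proof cases
    case 1
    then have "x \<le> x\<^sup>2" by (simp add: power2_eq_square)
    then have "exp x \<le> exp (x\<^sup>2)" by simp
    with 1 show ?thesis by linarith
  next
    case 2
    then show ?thesis using exp_bound[of x] sq by linarith
  next
    case 3
    have "exp x * (1 - x) \<le> exp x * exp (- x)"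
      using exp_ge_add_one_self[of "-x"] by (intro mult_left_mono) auto
    also have "\<dots> = 1" by (simp add: exp_minus)
    also have "1 \<le> (1 + x + x\<^sup>2) * (1 - x)"
    proof -
      have "x ^ 3 \<le> 0" using 3 by (simp add: power_le_zero_eq)
      then show ?thesis by (simp add: algebra_simps power2_eq_square power3_eq_cube)
    qed
    finally have "exp x \<le> 1 + x + x\<^sup>2" using 3 by simp
    then show ?thesis using sq by linarith
  next
    case 4
    then have "0 \<le> (-x - 1) * (-x)" by (intro mult_nonneg_nonneg) auto
    then have "0 \<le> x + x\<^sup>2" by (simp add: algebra_simps power2_eq_square)
    moreover have "exp x \<le> 1" using 4 by simp
    ultimately show ?thesis using sq by linarith
  qed
qed

text \<open>
  The method of conditional expectations, applied to the exponential moments of Hoeffding's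
  inequality: the bound \<open>e^z \<le> z + e^{z^2}\<close> replaces each exponential moment by a function that is
  affine in the weights, to which the previous lemma applies.
\<close>

lemma exponential_moment_selection:
  fixes w :: "'j \<Rightarrow> 'a \<Rightarrow> real" and F :: "'j \<Rightarrow> 'x \<Rightarrow> 'a \<Rightarrow> real" and B :: "('a \<Rightarrow> real) set"
    and c :: "'j \<Rightarrow> 'x \<Rightarrow> real" and P :: "'a set"
  defines "good \<equiv> \<lambda>j v. (\<forall>p\<in>P. 0 \<le> v p) \<and> (\<forall>p\<in>P. w j p = 0 \<longrightarrow> v p = 0)
    \<and> (\<forall>b\<in>B. (\<Sum>p\<in>P. v p * b p) = (\<Sum>p\<in>P. w j p * b p))"
  assumes "finite J" "finite P" "finite B" "finite X"
    and one: "\<And>u. (\<forall>b\<in>B. (\<Sum>p\<in>P. u p * b p) = 0) \<Longrightarrow> (\<Sum>p\<in>P. u p) = 0"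
    and w: "\<And>j p. j \<in> J \<Longrightarrow> p \<in> P \<Longrightarrow> 0 \<le> w j p"
    and c: "\<And>j x v. j \<in> J \<Longrightarrow> x \<in> X \<Longrightarrow> good j v \<Longrightarrow>
      \<bar>(\<Sum>p\<in>P. v p * F j x p) - (\<Sum>p\<in>P. w j p * F j x p)\<bar> \<le> c j x"
  shows "\<exists>v. (\<forall>j\<in>J. good j (v j) \<and> card {p\<in>P. v j p \<noteq> 0} \<le> card B) \<and>
    (\<Sum>x\<in>X. exp (L * (\<Sum>j\<in>J. (\<Sum>p\<in>P. v j p * F j x p) - (\<Sum>p\<in>P. w j p * F j x p))
      - L\<^sup>2 * (\<Sum>j\<in>J. (c j x)\<^sup>2))) \<le> card X"
  using assms(2) w c
proof (induction J rule: finite_induct)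
  case empty
  then show ?case by simp
next
  case (insert j J)
  let ?D = "\<lambda>v j x. (\<Sum>p\<in>P. v p * F j x p) - (\<Sum>p\<in>P. w j p * F j x p)"
  obtain v where v: "\<forall>j\<in>J. good j (v j) \<and> card {p\<in>P. v j p \<noteq> 0} \<le> card B"
    "(\<Sum>x\<in>X. exp (L * (\<Sum>j\<in>J. ?D (v j) j x) - L\<^sup>2 * (\<Sum>j\<in>J. (c j x)\<^sup>2))) \<le> card X"
    using insert.IH insert.prems by (force simp: good_def)
  \<comment> \<open>\<open>W x\<close> is the potential of \<open>x\<close> after the indices in
    \<open>J\<close>. The updated potential is at most affine in the deviation caused by
    \<open>u\<close>, with slope \<open>a x\<close>; hence the objective weighted by
    \<open>a x\<close> is the one that must not increase.\<close>
  define W where "W x = exp (L * (\<Sum>j\<in>J. ?D (v j) j x) - L\<^sup>2 * (\<Sum>j\<in>J. (c j x)\<^sup>2))" for x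
  define a where "a x = W x * exp (- (L\<^sup>2 * (c j x)\<^sup>2)) * L" for x
  obtain u where u: "good j u" "card {p\<in>P. u p \<noteq> 0} \<le> card B"
    "(\<Sum>p\<in>P. u p * (\<Sum>x\<in>X. a x * F j x p)) \<le> (\<Sum>p\<in>P. w j p * (\<Sum>x\<in>X. a x * F j x p))"
    using reduce_support[OF assms(3,4) one, of "w j" "\<lambda>p. \<Sum>x\<in>X. a x * F j x p"]
      insert.prems(1) unfolding good_def by blast
  have swap: "(\<Sum>p\<in>P. u p * (\<Sum>x\<in>X. a x * F j x p)) = (\<Sum>x\<in>X. a x * (\<Sum>p\<in>P. u p * F j x p))" for u
    unfolding sum_distrib_left by (subst sum.swap) (simp add: ac_simps)
  have lin: "(\<Sum>x\<in>X. a x * ?D u j x) \<le> 0"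
    using u(3) unfolding swap by (simp add: right_diff_distrib sum_subtractf)
  define v' where "v' = v(j := u)"
  have v'J: "v' i = v i" if "i \<in> J" for i using that insert.hyps by (auto simp: v'_def)
  have v'j: "v' j = u" by (simp add: v'_def)
  have step: "exp (L * (\<Sum>j\<in>insert j J. ?D (v' j) j x) - L\<^sup>2 * (\<Sum>j\<in>insert j J. (c j x)\<^sup>2))
      \<le> W x + a x * ?D u j x" if x: "x \<in> X" for x
  proof -
    have S: "(\<Sum>j\<in>insert j J. ?D (v' j) j x) = ?D u j x + (\<Sum>j\<in>J. ?D (v j) j x)"
      using insert.hyps v'J v'j by (simp cong: sum.cong)
    have C: "(\<Sum>j\<in>insert j J. (c j x)\<^sup>2) = (c j x)\<^sup>2 + (\<Sum>j\<in>J. (c j x)\<^sup>2)"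
      using insert.hyps by simp
    have D: "\<bar>?D u j x\<bar> \<le> c j x" using insert.prems(2)[OF insertI1 x u(1)] .
    have "(?D u j x)\<^sup>2 \<le> (c j x)\<^sup>2" using power_mono[OF D abs_ge_zero, of 2] by simp
    then have sq: "(L * ?D u j x)\<^sup>2 \<le> L\<^sup>2 * (c j x)\<^sup>2"
      by (simp add: power_mult_distrib mult_left_mono)
    have "exp (L * ?D u j x) \<le> L * ?D u j x + exp ((L * ?D u j x)\<^sup>2)"
      by (rule exp_le_add_exp_square)
    also have "\<dots> \<le> L * ?D u j x + exp (L\<^sup>2 * (c j x)\<^sup>2)" using sq by simp
    finally have "exp (L * ?D u j x) \<le> L * ?D u j x + exp (L\<^sup>2 * (c j x)\<^sup>2)" .
    then have "W x * exp (- (L\<^sup>2 * (c j x)\<^sup>2)) * exp (L * ?D u j x)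
        \<le> W x * exp (- (L\<^sup>2 * (c j x)\<^sup>2)) * (L * ?D u j x + exp (L\<^sup>2 * (c j x)\<^sup>2))"
      by (intro mult_left_mono) (auto simp: W_def)
    also have "\<dots> = W x + a x * ?D u j x"
      by (simp add: a_def algebra_simps exp_minus)
    also have "W x * exp (- (L\<^sup>2 * (c j x)\<^sup>2)) * exp (L * ?D u j x)
        = exp (L * (\<Sum>j\<in>insert j J. ?D (v' j) j x) - L\<^sup>2 * (\<Sum>j\<in>insert j J. (c j x)\<^sup>2))"
      unfolding W_def S C exp_add[symmetric] by (simp add: algebra_simps)
    finally show ?thesis .
  qed
  have "(\<Sum>x\<in>X. exp (L * (\<Sum>j\<in>insert j J. ?D (v' j) j x) - L\<^sup>2 * (\<Sum>j\<in>insert j J. (c j x)\<^sup>2)))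
      \<le> (\<Sum>x\<in>X. W x + a x * ?D u j x)"
    by (intro sum_mono step)
  also have "\<dots> \<le> card X" using lin v(2) by (simp add: sum.distrib W_def)
  finally show ?case using v(1) u(1,2) v'J v'j by (intro exI[of _ v']) auto
qed

text \<open>
  The parts of the two signed densities in each cell of \<open>\<gamma>\<close> are split into identical copies of mass at
  most \<open>2/N\<close>, which are sparsified separately. The copies count at most \<open>2N\<close> although the cells need
  not have comparable measures, and the variance at \<open>x\<close> is bounded by the mass of the cells on which
  \<open>\<Psi> x\<close> is not in the span of the moments.
\<close>

lemma sparse_signed_weights:
  fixes a :: "real \<Rightarrow> nat \<Rightarrow> real" and \<Psi> :: "nat \<Rightarrow> nat \<Rightarrow> real" and \<gamma> :: "nat \<Rightarrow> 'c"
    and B :: "(nat \<Rightarrow> real) set"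
  assumes "finite B" "finite C" and N: "N > 0" and C: "real (card C) \<le> real N / 2"
    and \<gamma>: "\<gamma> ` {..<K} \<subseteq> C"
    and one: "\<And>u. (\<forall>b\<in>B. (\<Sum>k<K. u k * b k) = 0) \<Longrightarrow> (\<Sum>k<K. u k) = 0"
    and a: "\<And>e k. 0 \<le> a e k" "(\<Sum>k<K. a 1 k + a (-1) k) \<le> 1"
    and osc: "\<And>x k k'. x < K \<Longrightarrow> k < K \<Longrightarrow> k' < K \<Longrightarrow> \<gamma> k = \<gamma> k' \<Longrightarrow> \<bar>\<Psi> x k - \<Psi> x k'\<bar> \<le> \<delta>"
    and exact: "\<And>x c u. x < K \<Longrightarrow> E x c \<Longrightarrow> (\<forall>k<K. \<gamma> k \<noteq> c \<longrightarrow> u k = 0) \<Longrightarrow>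
      (\<forall>b\<in>B. (\<Sum>k<K. u k * b k) = 0) \<Longrightarrow> (\<Sum>k<K. u k * \<Psi> x k) = 0"
    and \<kappa>: "\<And>x. x < K \<Longrightarrow> (\<Sum>k | k < K \<and> \<not> E x (\<gamma> k). a 1 k + a (-1) k) \<le> \<kappa>"
    and \<delta>: "0 \<le> \<delta>" and \<sigma>: "0 < \<sigma>" "8 * \<delta>\<^sup>2 * \<kappa> / real N \<le> \<sigma>\<^sup>2" and \<Lambda>: "0 < \<Lambda>" "ln (real (2 * K)) \<le> \<Lambda>"
  shows "\<exists>v. card {k. k < K \<and> v k \<noteq> 0} \<le> 2 * N * card B \<and> (\<Sum>k<K. \<bar>v k\<bar>) \<le> 1 \<and>
    (\<forall>x<K. \<bar>(\<Sum>k<K. (a 1 k - a (-1) k) * \<Psi> x k) - (\<Sum>k<K. v k * \<Psi> x k)\<bar> \<le> 2 * \<sigma> * sqrt \<Lambda>)"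
proof -
  define Sg where "Sg = {1, -1 :: real}"
  define b where "b ce = (\<Sum>k | k \<in> {..<K} \<and> \<gamma> k = fst ce. a (snd ce) k)" for ce
  \<comment> \<open>The floor plus one gives at least one copy and mass at most \<open>2/N\<close>
    per copy. The ones cost \<open>2 * card C \<le> N\<close> copies in total and the floors at most
    \<open>N/2\<close>, which stays below \<open>2 * N\<close>.\<close>
  define n where "n ce = nat \<lfloor>b ce * real N / 2\<rfloor> + 1" for ce
  define J where "J = (SIGMA ce : C \<times> Sg. {..<n ce})"
  define w where "w j k = (if \<gamma> k = fst (fst j) then a (snd (fst j)) k / real (n (fst j)) else 0)" for j :: "('c \<times> real) \<times> nat" and k
  \<comment> \<open>A test index is a point with a sign: the exponential moments bound deviations
    only from above, so each test function occurs with both signs. The factor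
    \<open>snd (fst j)\<close> restores the sign of the part of the density.\<close>
  define F where "F j x k = snd x * snd (fst j) * \<Psi> (fst x) k" for j :: "('c \<times> real) \<times> nat" and x :: "nat \<times> real" and k
  define c where "c j x = (if E (fst x) (fst (fst j)) then 0 else 2 * \<delta> * (b (fst j) / real (n (fst j))))"
    for j :: "('c \<times> real) \<times> nat" and x :: "nat \<times> real"
  have finJ: "finite J" unfolding J_def Sg_def using assms(2) by auto
  have n0: "real (n ce) > 0" for ce by (simp add: n_def)
  have b0: "0 \<le> b ce" for ce unfolding b_def by (intro sum_nonneg a)
  have bn: "b ce / real (n ce) \<le> 2 / real N" for ce
  proof -
    have "b ce * real N / 2 \<le> real (n ce)" unfolding n_def by linarith
    then show ?thesis using n0[of ce] N by (simp add: field_simps)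
  qed
  have group: "(\<Sum>cx\<in>C. \<Sum>k | k \<in> {..<K} \<and> \<gamma> k = cx. h k) = (\<Sum>k<K. h k)" for h :: "nat \<Rightarrow> real"
    by (rule sum.group) (use assms(2) \<gamma> in auto)
  have sumJ: "(\<Sum>j\<in>J. f (fst j)) = (\<Sum>cx\<in>C. \<Sum>e\<in>Sg. real (n (cx, e)) * f (cx, e))" for f :: "'c \<times> real \<Rightarrow> real"
  proof -
    have "(\<Sum>j\<in>J. f (fst j)) = (\<Sum>ce\<in>C \<times> Sg. \<Sum>i<n ce. f ce)"
      unfolding J_def using assms(2) by (subst sum.Sigma) (auto simp: Sg_def split_def)
    also have "\<dots> = (\<Sum>ce\<in>C \<times> Sg. real (n ce) * f ce)" by simp
    finally show ?thesis by (simp add: sum.cartesian_product split_def)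
  qed
  have sumb: "(\<Sum>cx\<in>C. \<Sum>e\<in>Sg. b (cx, e)) \<le> 1"
  proof -
    have "(\<Sum>cx\<in>C. \<Sum>e\<in>Sg. b (cx, e)) = (\<Sum>cx\<in>C. \<Sum>k | k \<in> {..<K} \<and> \<gamma> k = cx. a 1 k + a (-1) k)"
      by (simp add: Sg_def b_def sum.distrib)
    then show ?thesis using group a(2) by simp
  qed
  have cardJ: "card J \<le> 2 * N"
  proof -
    have "real (card J) = (\<Sum>j\<in>J. 1)" by simp
    also have "\<dots> = (\<Sum>cx\<in>C. \<Sum>e\<in>Sg. real (n (cx, e)) * 1)" by (rule sumJ[of "\<lambda>_. 1"])
    also have "\<dots> \<le> (\<Sum>cx\<in>C. \<Sum>e\<in>Sg. b (cx, e) * (real N / 2) + 1)"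
    proof (intro sum_mono)
      fix cx e
      have "0 \<le> b (cx, e) * real N / 2" using b0 by simp
      then have "real (n (cx, e)) \<le> b (cx, e) * real N / 2 + 1" unfolding n_def by linarith
      then show "real (n (cx, e)) * 1 \<le> b (cx, e) * (real N / 2) + 1" by simp
    qed
    also have "\<dots> = (\<Sum>cx\<in>C. \<Sum>e\<in>Sg. b (cx, e)) * (real N / 2) + 2 * real (card C)"
      by (simp add: Sg_def sum.distrib sum_distrib_right distrib_right)
    also have "\<dots> \<le> 1 * (real N / 2) + real N"
      using sumb C by (intro add_mono mult_right_mono) auto
    also have "\<dots> \<le> real (2 * N)" by simp
    finally show ?thesis by linarith
  qed
  have w0: "0 \<le> w j k" for j k unfolding w_def using a n0 by auto
  have wsum: "(\<Sum>k<K. w j k) = b (fst j) / real (n (fst j))" for j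
  proof -
    have "(\<Sum>k<K. w j k) = (\<Sum>k | k \<in> {..<K} \<and> \<gamma> k = fst (fst j). a (snd (fst j)) k / real (n (fst j)))"
      unfolding w_def by (intro sum.mono_neutral_cong_right) auto
    then show ?thesis by (simp add: b_def sum_divide_distrib)
  qed
  have cbound: "\<bar>(\<Sum>k<K. v k * F j x k) - (\<Sum>k<K. w j k * F j x k)\<bar> \<le> c j x"
    if j: "j \<in> J" and x: "x \<in> {..<K} \<times> Sg"
      and v: "(\<forall>k\<in>{..<K}. 0 \<le> v k) \<and> (\<forall>k\<in>{..<K}. w j k = 0 \<longrightarrow> v k = 0)
        \<and> (\<forall>f\<in>B. (\<Sum>k<K. v k * f k) = (\<Sum>k<K. w j k * f k))" for j x v
  proof -
    define u where "u k = v k - w j k" for k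
    have xK: "fst x < K" using x by auto
    have sg: "\<bar>snd x * snd (fst j)\<bar> = 1" using x j by (auto simp: Sg_def J_def abs_mult)
    have supp: "\<forall>k<K. \<gamma> k \<noteq> fst (fst j) \<longrightarrow> u k = 0" using v by (auto simp: u_def w_def)
    have mom: "\<forall>f\<in>B. (\<Sum>k<K. u k * f k) = 0" using v by (simp add: u_def left_diff_distrib sum_subtractf)
    have u1: "(\<Sum>k<K. u k) = 0" by (rule one[OF mom])
    have "(\<Sum>k<K. v k * F j x k) - (\<Sum>k<K. w j k * F j x k) = (\<Sum>k<K. u k * F j x k)"
      by (simp add: u_def left_diff_distrib sum_subtractf)
    also have "\<dots> = (snd x * snd (fst j)) * (\<Sum>k<K. u k * \<Psi> (fst x) k)"
      by (simp add: F_def sum_distrib_left mult_ac)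
    finally have eq: "\<bar>(\<Sum>k<K. v k * F j x k) - (\<Sum>k<K. w j k * F j x k)\<bar> = \<bar>\<Sum>k<K. u k * \<Psi> (fst x) k\<bar>"
      using sg by (simp add: abs_mult)
    show ?thesis
    proof (cases "E (fst x) (fst (fst j))")
      case True
      then show ?thesis unfolding eq using exact[OF xK True supp mom] by (simp add: c_def)
    next
      case False
      have "\<bar>\<Sum>k<K. u k * \<Psi> (fst x) k\<bar> \<le> 2 * \<delta> * (\<Sum>k<K. w j k)"
      proof (cases "\<exists>k0<K. \<gamma> k0 = fst (fst j)")
        case True
        then obtain k0 where k0: "k0 < K" "\<gamma> k0 = fst (fst j)" by blast
        \<comment> \<open>Since \<open>u\<close> has total mass zero, a reference value on the cell
          may be subtracted. Then \<open>v\<close> and \<open>w j\<close>, which have equal mass,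
          contribute at most \<open>\<delta>\<close> times that mass each, whence the factor 2 in
          \<open>c\<close>.\<close>
        have "(\<Sum>k<K. u k * \<Psi> (fst x) k) = (\<Sum>k<K. u k * (\<Psi> (fst x) k - \<Psi> (fst x) k0))"
          using u1 by (simp add: right_diff_distrib sum_subtractf sum_distrib_right[symmetric])
        also have "\<bar>\<dots>\<bar> \<le> (\<Sum>k<K. (v k + w j k) * \<delta>)"
        proof (rule order_trans[OF sum_abs sum_mono])
          fix k assume k: "k \<in> {..<K}"
          show "\<bar>u k * (\<Psi> (fst x) k - \<Psi> (fst x) k0)\<bar> \<le> (v k + w j k) * \<delta>"
          proof (cases "\<gamma> k = fst (fst j)")
            case True
            have "0 \<le> v k" using v k by blast
            then have "\<bar>u k\<bar> \<le> v k + w j k" using w0[of j k] by (simp add: u_def abs_le_iff)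
            moreover have "\<bar>\<Psi> (fst x) k - \<Psi> (fst x) k0\<bar> \<le> \<delta>" using osc[OF xK] k k0 True by auto
            ultimately show ?thesis unfolding abs_mult by (intro mult_mono) auto
          next
            case False
            then show ?thesis using supp k v w0[of j k] \<delta> by auto
          qed
        qed
        also have "\<dots> = \<delta> * ((\<Sum>k<K. v k) + (\<Sum>k<K. w j k))"
          by (simp add: sum_distrib_right[symmetric] sum.distrib)
        also have "(\<Sum>k<K. v k) = (\<Sum>k<K. w j k)" using u1 by (simp add: u_def sum_subtractf)
        finally show ?thesis by simp
      next
        case False
        then have "(\<Sum>k<K. u k * \<Psi> (fst x) k) = 0" using supp by (intro sum.neutral) auto
        then show ?thesis using \<delta> w0 by (simp add: sum_nonneg)
      qed
      then show ?thesis unfolding eq c_def wsum using False by simp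
    qed
  qed
  \<comment> \<open>The exponential bound yields a deviation of at most
    \<open>\<Lambda> / L + L * \<sigma>\<^sup>2\<close>; this \<open>L\<close> balances the two
    terms.\<close>
  define L where "L = sqrt \<Lambda> / \<sigma>"
  have L: "L > 0" "L\<^sup>2 * \<sigma>\<^sup>2 = \<Lambda>" using \<Lambda> \<sigma> by (auto simp: L_def power_divide)
  let ?good = "\<lambda>j v. (\<forall>k\<in>{..<K}. 0 \<le> v k) \<and> (\<forall>k\<in>{..<K}. w j k = 0 \<longrightarrow> v k = 0)
      \<and> (\<forall>f\<in>B. (\<Sum>k<K. v k * f k) = (\<Sum>k<K. w j k * f k))"
  have "\<exists>V. (\<forall>j\<in>J. ?good j (V j) \<and> card {k \<in> {..<K}. V j k \<noteq> 0} \<le> card B) \<and>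
    (\<Sum>x\<in>{..<K} \<times> Sg. exp (L * (\<Sum>j\<in>J. (\<Sum>k<K. V j k * F j x k) - (\<Sum>k<K. w j k * F j x k))
      - L\<^sup>2 * (\<Sum>j\<in>J. (c j x)\<^sup>2))) \<le> card ({..<K} \<times> Sg)"
    by (rule exponential_moment_selection) (use finJ assms(1) one w0 cbound in \<open>auto simp: Sg_def\<close>)
  then obtain V where VJ: "\<forall>j\<in>J. ?good j (V j) \<and> card {k \<in> {..<K}. V j k \<noteq> 0} \<le> card B"
    and Vexp: "(\<Sum>x\<in>{..<K} \<times> Sg. exp (L * (\<Sum>j\<in>J. (\<Sum>k<K. V j k * F j x k) - (\<Sum>k<K. w j k * F j x k))
      - L\<^sup>2 * (\<Sum>j\<in>J. (c j x)\<^sup>2))) \<le> card ({..<K} \<times> Sg)"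
    by (elim exE conjE) (rule that)
  have V: "\<And>j k. j \<in> J \<Longrightarrow> k < K \<Longrightarrow> 0 \<le> V j k"
      "\<And>j f. j \<in> J \<Longrightarrow> f \<in> B \<Longrightarrow> (\<Sum>k<K. V j k * f k) = (\<Sum>k<K. w j k * f k)"
      "\<And>j. j \<in> J \<Longrightarrow> card {k \<in> {..<K}. V j k \<noteq> 0} \<le> card B"
    using VJ by blast+
  define v where "v k = (\<Sum>j\<in>J. snd (fst j) * V j k)" for k
  \<comment> \<open>One factor of the squared mass of a copy is bounded by \<open>2/N\<close>; the
    other, summed over the \<open>n\<close> copies, gives back the mass \<open>b\<close>. Only cells
    where \<open>E\<close> fails remain, and their total mass is at most
    \<open>\<kappa>\<close>.\<close>
  have var: "(\<Sum>j\<in>J. (c j x)\<^sup>2) \<le> \<sigma>\<^sup>2" if x: "x \<in> {..<K} \<times> Sg" for x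
  proof -
    have xK: "fst x < K" using x by auto
    have "(\<Sum>j\<in>J. (c j x)\<^sup>2) \<le> (\<Sum>j\<in>J. (\<lambda>ce. if E (fst x) (fst ce) then 0 else 8 * \<delta>\<^sup>2 / real N * (b ce / real (n ce))) (fst j))"
    proof (rule sum_mono)
      fix j :: "('c \<times> real) \<times> nat"
      have "(b (fst j) / real (n (fst j)))\<^sup>2 \<le> 2 / real N * (b (fst j) / real (n (fst j)))"
        unfolding power2_eq_square using bn b0 n0 by (intro mult_right_mono) auto
      then have "4 * \<delta>\<^sup>2 * (b (fst j) / real (n (fst j)))\<^sup>2 \<le> 4 * \<delta>\<^sup>2 * (2 / real N * (b (fst j) / real (n (fst j))))"
        by (intro mult_left_mono) auto
      then show "(c j x)\<^sup>2 \<le> (\<lambda>ce. if E (fst x) (fst ce) then 0 else 8 * \<delta>\<^sup>2 / real N * (b ce / real (n ce))) (fst j)"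
        by (simp add: c_def power2_eq_square mult_ac)
    qed
    also have "\<dots> = (\<Sum>cx\<in>C. \<Sum>e\<in>Sg. real (n (cx, e)) *
        (if E (fst x) (fst (cx, e)) then 0 else 8 * \<delta>\<^sup>2 / real N * (b (cx, e) / real (n (cx, e)))))"
      by (rule sumJ)
    also have "\<dots> = (\<Sum>cx\<in>C. \<Sum>e\<in>Sg. if E (fst x) cx then 0 else 8 * \<delta>\<^sup>2 / real N * b (cx, e))"
      by (intro sum.cong) (auto simp: n_def)
    also have "\<dots> = (\<Sum>cx\<in>C. \<Sum>k | k \<in> {..<K} \<and> \<gamma> k = cx. if E (fst x) (\<gamma> k) then 0 else 8 * \<delta>\<^sup>2 / real N * (a 1 k + a (-1) k))"
    proof (rule sum.cong[OF refl])
      fix cx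
      show "(\<Sum>e\<in>Sg. if E (fst x) cx then 0 else 8 * \<delta>\<^sup>2 / real N * b (cx, e))
        = (\<Sum>k | k \<in> {..<K} \<and> \<gamma> k = cx. if E (fst x) (\<gamma> k) then 0 else 8 * \<delta>\<^sup>2 / real N * (a 1 k + a (-1) k))"
      proof (cases "E (fst x) cx")
        case True
        then show ?thesis by (auto intro!: sum.neutral[symmetric])
      next
        case False
        then have "(\<Sum>k | k \<in> {..<K} \<and> \<gamma> k = cx. if E (fst x) (\<gamma> k) then 0 else 8 * \<delta>\<^sup>2 / real N * (a 1 k + a (-1) k))
          = (\<Sum>k | k \<in> {..<K} \<and> \<gamma> k = cx. 8 * \<delta>\<^sup>2 / real N * (a 1 k + a (-1) k))"
          by (intro sum.cong) auto
        then show ?thesis using False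
          by (simp only: sum_distrib_left[symmetric] sum.distrib) (simp add: Sg_def b_def distrib_left)
      qed
    qed
    also have "\<dots> = (\<Sum>k<K. if E (fst x) (\<gamma> k) then 0 else 8 * \<delta>\<^sup>2 / real N * (a 1 k + a (-1) k))"
      by (rule group)
    also have "\<dots> = (\<Sum>k | k < K \<and> \<not> E (fst x) (\<gamma> k). 8 * \<delta>\<^sup>2 / real N * (a 1 k + a (-1) k))"
      by (intro sum.mono_neutral_cong_right) auto
    also have "\<dots> = 8 * \<delta>\<^sup>2 / real N * (\<Sum>k | k < K \<and> \<not> E (fst x) (\<gamma> k). a 1 k + a (-1) k)"
      by (simp add: sum_distrib_left)
    also have "\<dots> \<le> 8 * \<delta>\<^sup>2 / real N * \<kappa>" by (intro mult_left_mono \<kappa> xK) auto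
    finally show ?thesis using \<sigma> by simp
  qed
  have one_sided: "(\<Sum>j\<in>J. (\<Sum>k<K. V j k * F j x k) - (\<Sum>k<K. w j k * F j x k)) \<le> 2 * \<sigma> * sqrt \<Lambda>"
    if x: "x \<in> {..<K} \<times> Sg" for x
  proof -
    define S where "S x = (\<Sum>j\<in>J. (\<Sum>k<K. V j k * F j x k) - (\<Sum>k<K. w j k * F j x k))" for x
    have K: "K > 0" using x by auto
    have "exp (L * S x - L\<^sup>2 * (\<Sum>j\<in>J. (c j x)\<^sup>2)) \<le> (\<Sum>x\<in>{..<K} \<times> Sg. exp (L * S x - L\<^sup>2 * (\<Sum>j\<in>J. (c j x)\<^sup>2)))"
      using x by (intro member_le_sum) (auto simp: Sg_def)
    also have "\<dots> \<le> real (2 * K)" using Vexp by (simp add: S_def Sg_def card_cartesian_product)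
    finally have "L * S x - L\<^sup>2 * (\<Sum>j\<in>J. (c j x)\<^sup>2) \<le> ln (real (2 * K))"
      using K by (subst ln_ge_iff) auto
    moreover have "L\<^sup>2 * (\<Sum>j\<in>J. (c j x)\<^sup>2) \<le> \<Lambda>"
      using mult_left_mono[OF var[OF x], of "L\<^sup>2"] L by simp
    ultimately have "L * S x \<le> 2 * \<Lambda>" using \<Lambda> by linarith
    also have "2 * \<Lambda> = L * (2 * \<sigma> * sqrt \<Lambda>)" using \<Lambda> \<sigma> by (simp add: L_def)
    finally show ?thesis using L(1) by (simp add: S_def)
  qed
  have diff: "(\<Sum>j\<in>J. (\<Sum>k<K. V j k * F j (x, \<tau>) k) - (\<Sum>k<K. w j k * F j (x, \<tau>) k))
    = \<tau> * ((\<Sum>k<K. v k * \<Psi> x k) - (\<Sum>k<K. (a 1 k - a (-1) k) * \<Psi> x k))" for x \<tau>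
  proof -
    have lin: "(\<Sum>j\<in>J. \<Sum>k<K. f j k * F j (x, \<tau>) k) = \<tau> * (\<Sum>k<K. (\<Sum>j\<in>J. snd (fst j) * f j k) * \<Psi> x k)" for f
      unfolding F_def sum_distrib_left sum_distrib_right by (subst sum.swap) (simp add: mult_ac)
    have "(\<Sum>j\<in>J. snd (fst j) * w j k) = a 1 k - a (-1) k" if k: "k \<in> {..<K}" for k
    proof -
      have "(\<Sum>j\<in>J. snd (fst j) * w j k)
          = (\<Sum>j\<in>J. (\<lambda>ce. snd ce * (if \<gamma> k = fst ce then a (snd ce) k / real (n ce) else 0)) (fst j))"
        by (simp add: w_def)
      also have "\<dots> = (\<Sum>cx\<in>C. \<Sum>e\<in>Sg. real (n (cx, e)) *
          (snd (cx, e) * (if \<gamma> k = fst (cx, e) then a (snd (cx, e)) k / real (n (cx, e)) else 0)))"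
        by (rule sumJ)
      also have "\<dots> = (\<Sum>cx\<in>C. \<Sum>e\<in>Sg. if cx = \<gamma> k then e * a e k else 0)"
        by (intro sum.cong) (auto simp: n_def)
      also have "\<dots> = (\<Sum>cx\<in>C. if cx = \<gamma> k then a 1 k - a (-1) k else 0)"
        by (intro sum.cong) (auto simp: Sg_def)
      also have "\<dots> = a 1 k - a (-1) k" using \<gamma> k assms(2) by (auto simp: sum.delta)
      finally show ?thesis .
    qed
    then show ?thesis by (simp add: sum_subtractf lin v_def right_diff_distrib)
  qed
  have "\<bar>(\<Sum>k<K. (a 1 k - a (-1) k) * \<Psi> x k) - (\<Sum>k<K. v k * \<Psi> x k)\<bar> \<le> 2 * \<sigma> * sqrt \<Lambda>" if "x < K" for x
    using one_sided[of "(x, 1)"] one_sided[of "(x, -1)"] that unfolding diff by (simp add: Sg_def)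
  moreover have "(\<Sum>k<K. \<bar>v k\<bar>) \<le> 1"
  proof -
    have "(\<Sum>k<K. \<bar>v k\<bar>) \<le> (\<Sum>k<K. \<Sum>j\<in>J. V j k)"
    proof (rule sum_mono)
      fix k assume k: "k \<in> {..<K}"
      have "\<bar>v k\<bar> \<le> (\<Sum>j\<in>J. \<bar>snd (fst j) * V j k\<bar>)" unfolding v_def by (rule sum_abs)
      also have "\<dots> = (\<Sum>j\<in>J. V j k)"
        using V(1) k by (intro sum.cong) (auto simp: abs_mult J_def Sg_def)
      finally show "\<bar>v k\<bar> \<le> (\<Sum>j\<in>J. V j k)" .
    qed
    also have "\<dots> = (\<Sum>j\<in>J. \<Sum>k<K. V j k)" by (rule sum.swap)
    also have "\<dots> = (\<Sum>j\<in>J. (\<lambda>ce. b ce / real (n ce)) (fst j))"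
    proof (rule sum.cong[OF refl])
      fix j assume j: "j \<in> J"
      have "(\<Sum>k<K. V j k - w j k) = 0"
        using V(2)[OF j] by (intro one) (simp add: left_diff_distrib sum_subtractf)
      then show "(\<Sum>k<K. V j k) = (\<lambda>ce. b ce / real (n ce)) (fst j)"
        by (simp add: sum_subtractf wsum)
    qed
    also have "\<dots> = (\<Sum>cx\<in>C. \<Sum>e\<in>Sg. real (n (cx, e)) * (b (cx, e) / real (n (cx, e))))"
      by (rule sumJ)
    also have "\<dots> = (\<Sum>cx\<in>C. \<Sum>e\<in>Sg. b (cx, e))"
      by (intro sum.cong) (auto simp: n_def)
    finally show ?thesis using sumb by linarith
  qed
  moreover have "card {k. k < K \<and> v k \<noteq> 0} \<le> 2 * N * card B"
  proof -
    have "{k. k < K \<and> v k \<noteq> 0} \<subseteq> (\<Union>j\<in>J. {k \<in> {..<K}. V j k \<noteq> 0})"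
      unfolding v_def by (auto intro: ccontr elim!: sum.not_neutral_contains_not_neutral)
    then have "card {k. k < K \<and> v k \<noteq> 0} \<le> card (\<Union>j\<in>J. {k \<in> {..<K}. V j k \<noteq> 0})"
      using finJ by (intro card_mono) auto
    also have "\<dots> \<le> (\<Sum>j\<in>J. card {k \<in> {..<K}. V j k \<noteq> 0})" by (rule card_UN_le[OF finJ])
    also have "\<dots> \<le> (\<Sum>j\<in>J. card B)" by (intro sum_mono V(3))
    also have "\<dots> \<le> 2 * N * card B" using cardJ by simp
    finally show ?thesis .
  qed
  ultimately show ?thesis by blast
qed

subsection \<open>Spherical polynomials\<close>

lemma monomial_in_polynomials_deg_le:
  assumes "(\<Sum>i\<in>UNIV. k i) \<le> r"
  shows "(\<lambda>x :: real ^ 'n. \<Prod>i\<in>UNIV. x $ i ^ k i) \<in> polynomials_deg_le r"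
  unfolding polynomials_deg_le_def
proof (intro CollectI exI[of _ "\<lambda>m. of_bool (m = k)"] conjI TrueI ext)
  fix x :: "real ^ 'n"
  have "(\<Sum>m | sum m UNIV \<le> r. of_bool (m = k) * (\<Prod>i\<in>UNIV. x $ i ^ m i))
      = (\<Sum>m | sum m UNIV \<le> r. if m = k then \<Prod>i\<in>UNIV. x $ i ^ m i else 0)"
    by (intro sum.cong) auto
  then show "(\<Prod>i\<in>UNIV. x $ i ^ k i) = (\<Sum>m | sum m UNIV \<le> r. of_bool (m = k) * (\<Prod>i\<in>UNIV. x $ i ^ m i))"
    using assms finite_exponents[of r, where 'n = 'n] by (simp add: sum.delta)
qed

lemma polynomials_deg_le_scale:
  assumes "f \<in> polynomials_deg_le r"
  shows "(\<lambda>x. a * f x) \<in> polynomials_deg_le r"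
proof -
  obtain c where "f = (\<lambda>x. \<Sum>k | (\<Sum>i\<in>UNIV. k i) \<le> r. c k * (\<Prod>i\<in>UNIV. x $ i ^ k i))"
    using assms by (auto simp: polynomials_deg_le_def)
  then show ?thesis unfolding polynomials_deg_le_def
    by (intro CollectI exI[of _ "\<lambda>k. a * c k"]) (simp add: sum_distrib_left mult.assoc)
qed

lemma polynomials_deg_le_add:
  assumes "f \<in> polynomials_deg_le r" "g \<in> polynomials_deg_le r"
  shows "(\<lambda>x. f x + g x) \<in> polynomials_deg_le r"
proof -
  obtain a b where "f = (\<lambda>x. \<Sum>k | (\<Sum>i\<in>UNIV. k i) \<le> r. a k * (\<Prod>i\<in>UNIV. x $ i ^ k i))"
    "g = (\<lambda>x. \<Sum>k | (\<Sum>i\<in>UNIV. k i) \<le> r. b k * (\<Prod>i\<in>UNIV. x $ i ^ k i))"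
    using assms by (auto simp: polynomials_deg_le_def)
  then show ?thesis unfolding polynomials_deg_le_def
    by (intro CollectI exI[of _ "\<lambda>k. a k + b k"]) (simp add: sum.distrib algebra_simps)
qed

lemma polynomials_deg_le_zero: "(\<lambda>x. 0) \<in> polynomials_deg_le r"
  unfolding polynomials_deg_le_def by (intro CollectI exI[of _ "\<lambda>_. 0"]) simp

lemma polynomials_deg_le_sum:
  assumes "finite A" "\<And>a. a \<in> A \<Longrightarrow> f a \<in> polynomials_deg_le r"
  shows "(\<lambda>x. \<Sum>a\<in>A. f a x) \<in> polynomials_deg_le r"
  using assms by (induction A rule: finite_induct) (auto intro: polynomials_deg_le_add polynomials_deg_le_zero)

lemma polynomials_deg_le_mono:
  assumes "f \<in> polynomials_deg_le r" "r \<le> r'"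
  shows "f \<in> polynomials_deg_le r'"
proof -
  obtain c where f: "f = (\<lambda>x. \<Sum>k | (\<Sum>i\<in>UNIV. k i) \<le> r. c k * (\<Prod>i\<in>UNIV. x $ i ^ k i))"
    using assms by (auto simp: polynomials_deg_le_def)
  show ?thesis unfolding f using assms(2)
    by (intro polynomials_deg_le_sum finite_exponents polynomials_deg_le_scale
          monomial_in_polynomials_deg_le) auto
qed

lemma polynomials_deg_le_coordinate_mult:
  fixes f :: "real ^ 'n \<Rightarrow> real"
  assumes "f \<in> polynomials_deg_le r"
  shows "(\<lambda>x. x $ j * f x) \<in> polynomials_deg_le (Suc r)"
proof -
  obtain c where f: "f = (\<lambda>x. \<Sum>k | (\<Sum>i\<in>UNIV. k i) \<le> r. c k * (\<Prod>i\<in>UNIV. x $ i ^ k i))"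
    using assms by (auto simp: polynomials_deg_le_def)
  have prod: "x $ j * (\<Prod>i\<in>UNIV. x $ i ^ k i) = (\<Prod>i\<in>UNIV. x $ i ^ (k(j := Suc (k j))) i)"
    for x :: "real ^ 'n" and k
    by (subst (1 2) prod.remove[of UNIV j]) (auto intro!: prod.cong)
  have sum: "(\<Sum>i\<in>UNIV. (k(j := Suc (k j))) i) = Suc (\<Sum>i\<in>UNIV. k i)" for k :: "'n \<Rightarrow> nat"
    by (subst (1 2) sum.remove[of UNIV j]) (auto intro!: sum.cong)
  have "(\<lambda>x. x $ j * f x) = (\<lambda>x. \<Sum>k | (\<Sum>i\<in>UNIV. k i) \<le> r. c k * (\<Prod>i\<in>UNIV. x $ i ^ (k(j := Suc (k j))) i))"
    unfolding f by (simp add: sum_distrib_left prod[symmetric] mult_ac del: fun_upd_apply)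
  also have "\<dots> \<in> polynomials_deg_le (Suc r)"
    by (intro polynomials_deg_le_sum finite_exponents polynomials_deg_le_scale
          monomial_in_polynomials_deg_le) (simp add: sum del: fun_upd_apply)
  finally show ?thesis .
qed

lemma inner_power_in_polynomials_deg_le:
  "(\<lambda>y :: real ^ 'n. (x \<bullet> y) ^ k) \<in> polynomials_deg_le k"
proof (induction k)
  case 0
  have "(\<lambda>y :: real ^ 'n. \<Prod>i\<in>UNIV. y $ i ^ 0) \<in> polynomials_deg_le 0"
    by (rule monomial_in_polynomials_deg_le) simp
  then show ?case by simp
next
  case (Suc k)
  have inner: "x \<bullet> y = (\<Sum>j\<in>UNIV. x $ j * y $ j)" for y by (simp add: inner_vec_def)
  have "(x \<bullet> y) ^ Suc k = (\<Sum>j\<in>UNIV. x $ j * (y $ j * (x \<bullet> y) ^ k))" for y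
    unfolding power_Suc by (subst inner) (simp only: sum_distrib_right mult.assoc)
  then have "(\<lambda>y. (x \<bullet> y) ^ Suc k) = (\<lambda>y. \<Sum>j\<in>UNIV. x $ j * (y $ j * (x \<bullet> y) ^ k))"
    by simp
  also have "\<dots> \<in> polynomials_deg_le (Suc k)"
    by (intro polynomials_deg_le_sum polynomials_deg_le_scale polynomials_deg_le_coordinate_mult Suc) auto
  finally show ?case .
qed

lemma poly_inner_in_polynomials_deg_le:
  assumes "degree q \<le> r"
  shows "(\<lambda>y :: real ^ 'n. poly q (x \<bullet> y)) \<in> polynomials_deg_le r"
proof -
  have "(\<lambda>y. poly q (x \<bullet> y)) = (\<lambda>y. \<Sum>i\<le>degree q. coeff q i * (x \<bullet> y) ^ i)"
    by (simp add: poly_altdef)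
  also have "\<dots> \<in> polynomials_deg_le r"
    using assms by (intro polynomials_deg_le_sum polynomials_deg_le_scale
      polynomials_deg_le_mono[OF inner_power_in_polynomials_deg_le]) auto
  finally show ?thesis .
qed

lemma poly_inner_in_spherical_polynomials:
  assumes "degree q \<le> r"
  shows "(\<lambda>y :: real ^ 'n. if y \<in> sphere 0 1 then poly q (x \<bullet> y) else 0) \<in> spherical_polynomials r"
  unfolding spherical_polynomials_def using poly_inner_in_polynomials_deg_le[OF assms] by (rule imageI)

text \<open>
  The dimension of an infinite-dimensional space would be the cardinality \<open>0\<close> of an infinite basis,
  so finiteness of the basis needs the finite spanning set of monomials.
\<close>

lemma spherical_polynomials_basis:
  obtains B :: "(real ^ 'n \<Rightarrow> real) set" where "finite B"
    "card B = dim_spherical_polynomials TYPE('n) r" "spherical_polynomials r \<subseteq> fun_space.span B"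
proof -
  obtain B :: "(real ^ 'n \<Rightarrow> real) set" where B: "B \<subseteq> spherical_polynomials r" "fun_space.independent B"
    "spherical_polynomials r \<subseteq> fun_space.span B" "card B = fun_space.dim (spherical_polynomials r :: (real ^ 'n \<Rightarrow> real) set)"
    using fun_space.basis_exists[of "spherical_polynomials r :: (real ^ 'n \<Rightarrow> real) set"] by blast
  define E where "E = (\<lambda>k. (\<lambda>x :: real ^ 'n. if x \<in> sphere 0 1 then \<Prod>i\<in>UNIV. x $ i ^ k i else 0)) `
    {k. (\<Sum>i\<in>UNIV. k i) \<le> r}"
  have "finite E" unfolding E_def by (intro finite_imageI finite_exponents)
  have "f \<in> fun_space.span E" if fs: "f \<in> spherical_polynomials r" for f :: "real ^ 'n \<Rightarrow> real"
  proof -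
    obtain p where p: "p \<in> polynomials_deg_le r" and fp: "f = (\<lambda>x. if x \<in> sphere 0 1 then p x else 0)"
      using fs unfolding spherical_polynomials_def by (elim imageE) (rule that)
    obtain c where c: "p = (\<lambda>x. \<Sum>k | (\<Sum>i\<in>UNIV. k i) \<le> r. c k * (\<Prod>i\<in>UNIV. x $ i ^ k i))"
      using p by (auto simp: polynomials_deg_le_def)
    have sum_apply: "(\<Sum>a\<in>A. g a) x = (\<Sum>a\<in>A. g a x)" for A and g :: "('n \<Rightarrow> nat) \<Rightarrow> real ^ 'n \<Rightarrow> real" and x
      by (induction A rule: infinite_finite_induct) auto
    have "f = (\<Sum>k | (\<Sum>i\<in>UNIV. k i) \<le> r. scale_fun (c k)
        (\<lambda>x. if x \<in> sphere 0 1 then \<Prod>i\<in>UNIV. x $ i ^ k i else 0))"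
      by (simp add: fp c fun_eq_iff sum_apply scale_fun_def)
    also have "\<dots> \<in> fun_space.span E"
      by (intro fun_space.span_sum fun_space.span_scale fun_space.span_base) (auto simp: E_def)
    finally show ?thesis .
  qed
  then have "B \<subseteq> fun_space.span E" using B(1) by blast
  then have "finite B" using fun_space.independent_span_bound[OF \<open>finite E\<close> B(2)] by blast
  then show thesis using that B unfolding dim_spherical_polynomials_def by blast
qed

text \<open>The sparsification prescribes only the moments of a basis; by linearity the agreement
  extends to the whole span. \<open>\<phi>\<close> lets the sums run over indices of net
  points.\<close>

lemma equal_moments_span:
  assumes "f \<in> fun_space.span B" "\<And>b. b \<in> B \<Longrightarrow> (\<Sum>p\<in>P. u p * b (\<phi> p)) = (\<Sum>p\<in>P. w p * b (\<phi> p))"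
  shows "(\<Sum>p\<in>P. u p * f (\<phi> p)) = (\<Sum>p\<in>P. (w p :: real) * f (\<phi> p))"
  using assms(1)
proof (induction rule: fun_space.span_induct_alt)
  case base
  then show ?case by simp
next
  case (step c b g)
  have e: "(\<Sum>p\<in>P. u p * (scale_fun c b + g) (\<phi> p)) = c * (\<Sum>p\<in>P. u p * b (\<phi> p)) + (\<Sum>p\<in>P. u p * g (\<phi> p))" for u
    by (simp add: scale_fun_def distrib_left sum.distrib sum_distrib_left mult_ac)
  show ?case unfolding e using step assms(2) by simp
qed

subsection \<open>Nets and slabs on the sphere\<close>

text \<open>Factors out \<open>a - b\<close> explicitly; applied to the volumes of thin shells and
  to annular slices of shells.\<close>

lemma power_Suc_diff_le:
  fixes a b :: real
  assumes "0 \<le> b" "b \<le> a"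
  shows "a ^ Suc d - b ^ Suc d \<le> real (Suc d) * (a - b) * a ^ d"
proof -
  have "a ^ Suc d - b ^ Suc d = (a - b) * (\<Sum>p<Suc d. a ^ p * b ^ (d - p))"
    using diff_power_eq_sum[of a d b] .
  also have "(\<Sum>p<Suc d. a ^ p * b ^ (d - p)) \<le> (\<Sum>p<Suc d. a ^ d)"
  proof (rule sum_mono)
    fix p assume "p \<in> {..<Suc d}"
    then have "a ^ d = a ^ p * a ^ (d - p)" by (simp flip: power_add)
    moreover have "a ^ p * b ^ (d - p) \<le> a ^ p * a ^ (d - p)"
      using assms by (intro mult_left_mono power_mono) auto
    ultimately show "a ^ p * b ^ (d - p) \<le> a ^ d" by simp
  qed
  then have "(a - b) * (\<Sum>p<Suc d. a ^ p * b ^ (d - p)) \<le> (a - b) * (real (Suc d) * a ^ d)"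
    using assms by (intro mult_left_mono) auto
  finally show ?thesis by (simp add: mult_ac)
qed

text \<open>Packing of balls of half the separation \<open>u\<close>, but in the shell between the
  radii \<open>1 - u\<close> and \<open>1 + u\<close> instead of a ball. The volume of the shell is
  linear in \<open>u\<close>, which cancels one power of \<open>u\<close> and leaves the exponent
  \<open>d\<close> of the sphere in place of \<open>d + 1\<close>.\<close>

lemma card_separated_sphere_le:
  fixes T :: "'a :: euclidean_space set"
  assumes d: "DIM('a) = d + 1" and \<rho>: "0 < \<rho>" "\<rho> \<le> 2"
    and T: "finite T" "T \<subseteq> sphere 0 1"
    and sep: "\<And>a b. a \<in> T \<Longrightarrow> b \<in> T \<Longrightarrow> a \<noteq> b \<Longrightarrow> \<rho> \<le> dist a b"
  shows "real (card T) \<le> 2 * (real d + 1) * (4 / \<rho>) ^ d"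
proof -
  define u where "u = \<rho> / 2"
  have u: "0 < u" "u \<le> 1" using \<rho> by (auto simp: u_def)
  define V where "V = unit_ball_vol (real (d + 1))"
  have V: "V > 0" by (simp add: V_def)
  have fm: "ball c r \<in> fmeasurable lborel" "cball c r \<in> fmeasurable lborel" for c :: 'a and r
    by (auto intro!: fmeasurableI emeasure_lborel_ball_finite emeasure_lborel_cball_finite)
  have mb: "measure lborel (ball c r) = V * r ^ (d + 1)" "measure lborel (cball c r) = V * r ^ (d + 1)"
    if "0 \<le> r" for c :: 'a and r
    using content_ball[OF that, of c] content_cball[OF that, of c] by (simp_all add: d V_def)
  have "measure lborel (\<Union>t\<in>T. ball t u) = (\<Sum>t\<in>T. measure lborel (ball t u))"
  proof (rule measure_finite_Union[OF T(1)])
    show "disjoint_family_on (\<lambda>t. ball t u) T"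
    proof (unfold disjoint_family_on_def, intro ballI impI)
      fix a b assume "a \<in> T" "b \<in> T" "a \<noteq> b"
      then have "2 * u \<le> dist a b" using sep by (simp add: u_def)
      then show "ball a u \<inter> ball b u = {}"
        by (auto simp: disjoint_iff) (metis dist_commute dist_triangle_less_add not_less mult_2)
    qed
    show "emeasure lborel (ball t u) \<noteq> \<infinity>" for t :: 'a
      using emeasure_lborel_ball_finite[of t u] by simp
  qed auto
  then have "real (card T) * (V * u ^ (d + 1)) = measure lborel (\<Union>t\<in>T. ball t u)"
    using u mb by simp
  also have "\<dots> \<le> measure lborel (cball 0 (1 + u) - ball 0 (1 - u) :: 'a set)"
  proof (rule measure_mono_fmeasurable)
    show "(\<Union>t\<in>T. ball t u) \<subseteq> cball 0 (1 + u) - ball 0 (1 - u)"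
    proof
      fix y assume "y \<in> (\<Union>t\<in>T. ball t u)"
      then obtain t where t: "t \<in> T" "dist t y < u" by auto
      then have "norm t = 1" using T(2) by auto
      have "norm y \<le> norm t + dist t y" "norm t \<le> norm y + dist t y"
        by (simp_all add: dist_norm norm_triangle_sub norm_minus_commute[of t y])
           (metis norm_minus_commute norm_triangle_sub)
      then show "y \<in> cball 0 (1 + u) - ball 0 (1 - u)" using t(2) \<open>norm t = 1\<close> by auto
    qed
    show "cball 0 (1 + u) - ball 0 (1 - u) \<in> fmeasurable (lborel :: 'a measure)"
      by (intro fmeasurable_Diff fm) auto
  qed (use T in auto)
  also have "\<dots> = measure lborel (cball 0 (1 + u) :: 'a set) - measure lborel (ball 0 (1 - u) :: 'a set)"
    using u by (intro measurable_measure_Diff fm) auto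
  also have "\<dots> = V * ((1 + u) ^ Suc d - (1 - u) ^ Suc d)"
    using u mb by (simp add: algebra_simps)
  also have "\<dots> \<le> V * (real (Suc d) * (2 * u) * (1 + u) ^ d)"
    using power_Suc_diff_le[of "1 - u" "1 + u" d] u V by (intro mult_left_mono) auto
  also have "\<dots> \<le> V * (real (Suc d) * (2 * u) * 2 ^ d)"
    using u V by (intro mult_left_mono power_mono) auto
  finally have "(V * u) * (real (card T) * u ^ d) \<le> (V * u) * (2 * (real d + 1) * 2 ^ d)"
    by (simp add: algebra_simps)
  then have "real (card T) * u ^ d \<le> 2 * (real d + 1) * 2 ^ d"
    using u V by (simp only: mult_le_cancel_left_pos mult_pos_pos)
  then have "real (card T) \<le> 2 * (real d + 1) * (2 ^ d / u ^ d)"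
    using u by (simp add: field_simps)
  also have "2 ^ d / u ^ d = (4 / \<rho>) ^ d"
    by (simp add: u_def power_divide[symmetric])
  finally show ?thesis .
qed

text \<open>A separated set of maximal cardinality is a net, since an uncovered point could be added
  to it. The packing bound shows that a maximum exists and also counts the net.\<close>

lemma sphere_net_exists:
  assumes d: "DIM('a) = d + 1" and \<rho>: "0 < \<rho>" "\<rho> \<le> 2"
  obtains T :: "'a :: euclidean_space set" where "finite T" "T \<noteq> {}" "T \<subseteq> sphere 0 1"
    "real (card T) \<le> 2 * (real d + 1) * (4 / \<rho>) ^ d"
    "\<And>y. y \<in> sphere 0 1 \<Longrightarrow> \<exists>t\<in>T. dist y t \<le> \<rho>"
proof -
  define sep where "sep T \<longleftrightarrow> finite T \<and> T \<subseteq> sphere (0 :: 'a) 1 \<and>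
    (\<forall>a\<in>T. \<forall>b\<in>T. a \<noteq> b \<longrightarrow> \<rho> \<le> dist a b)" for T
  have bound: "real (card T) \<le> 2 * (real d + 1) * (4 / \<rho>) ^ d" if "sep T" for T
    using card_separated_sphere_le[OF d \<rho>, of T] that unfolding sep_def by auto
  have "sep {}" by (simp add: sep_def)
  then obtain T where T: "sep T" "\<And>T'. sep T' \<Longrightarrow> card T' \<le> card T"
  proof -
    have "\<forall>T. sep T \<longrightarrow> card T < Suc (nat \<lfloor>2 * (real d + 1) * (4 / \<rho>) ^ d\<rfloor>)"
      using bound by (auto intro: le_nat_floor simp: less_Suc_eq_le)
    from ex_has_greatest_nat[OF \<open>sep {}\<close> this] show thesis using that by metis
  qed
  have cover: "\<exists>t\<in>T. dist y t \<le> \<rho>" if y: "y \<in> sphere 0 1" for y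
  proof (rule ccontr)
    assume "\<not> (\<exists>t\<in>T. dist y t \<le> \<rho>)"
    then have far: "\<forall>t\<in>T. \<rho> < dist y t" by force
    then have "y \<notin> T" using \<rho> by auto
    moreover have "sep (insert y T)"
      using T(1) y far unfolding sep_def by (auto simp: dist_commute less_imp_le)
    ultimately show False using T(2)[of "insert y T"] T(1) by (simp add: sep_def)
  qed
  moreover have "T \<noteq> {}"
  proof -
    obtain b :: 'a where "b \<in> Basis" using nonempty_Basis by blast
    then show ?thesis using cover[of b] by auto
  qed
  ultimately show thesis using that[of T] T(1) bound unfolding sep_def by blast
qed

section \<open>Invariance of Lebesgue measure under isometries\<close>

lemma emeasure_lborel_translation:
  fixes A :: "'a :: euclidean_space set"
  assumes "A \<in> sets borel"
  shows "emeasure lborel ((\<lambda>x. c + x) -` A) = emeasure lborel A"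
proof -
  have "emeasure lborel A = emeasure (distr lborel borel (\<lambda>x. c + x)) A"
    using lborel_affine[of 1 c] by (simp add: density_1)
  also have "\<dots> = emeasure lborel ((\<lambda>x. c + x) -` A)"
    using assms by (subst emeasure_distr) auto
  finally show ?thesis by simp
qed

lemma emeasure_lborel_reflection:
  fixes A :: "'a :: euclidean_space set"
  assumes "A \<in> sets borel"
  shows "emeasure lborel ((\<lambda>x. c - x) -` A) = emeasure lborel A"
proof -
  have "emeasure lborel A = emeasure (distr lborel borel (\<lambda>x. c - x)) A"
    using lborel_affine[of "-1" c] by (simp add: density_1)
  also have "\<dots> = emeasure lborel ((\<lambda>x. c - x) -` A)"
    using assms by (subst emeasure_distr) auto
  finally show ?thesis by simp
qed

text \<open>
  Uniqueness of Haar measure specialised to the image of Lebesgue measure under \<open>f\<close>: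
  \<open>\<lambda>(f\<^sup>-\<^sup>1 A) \<lambda>(C) = \<lambda>(f\<^sup>-\<^sup>1 C) \<lambda>(A)\<close> by Fubini, and the unit ball satisfies \<open>f\<^sup>-\<^sup>1 C = C\<close>.
\<close>

lemma emeasure_lborel_orthogonal_vimage:
  fixes f :: "'a :: euclidean_space \<Rightarrow> 'a"
  assumes f: "orthogonal_transformation f" and A: "A \<in> sets borel"
  shows "emeasure lborel (f -` A) = emeasure lborel A"
proof -
  have lin: "linear f" using f by (rule orthogonal_transformation_linear)
  have [measurable]: "f \<in> borel_measurable borel"
    by (intro borel_measurable_continuous_onI linear_continuous_on linear_conv_bounded_linear[THEN iffD1] lin)
  note [measurable] = A
  define C where "C = cball (0 :: 'a) 1"
  have [measurable]: "C \<in> sets borel" by (simp add: C_def)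
  have fC: "f -` C = C" using f by (auto simp: C_def orthogonal_transformation_norm)
  have fm: "f -` S \<in> sets borel" if "S \<in> sets borel" for S
    using measurable_sets[OF \<open>f \<in> borel_measurable borel\<close> that] by simp
  have "emeasure lborel (f -` A) * emeasure lborel C
      = (\<integral>\<^sup>+x. indicator A (f x) * emeasure lborel C \<partial>lborel)"
    using fm[OF A] by (subst nn_integral_multc) (auto simp: nn_integral_indicator[symmetric] indicator_vimage[symmetric] simp del: nn_integral_indicator)
  also have "\<dots> = (\<integral>\<^sup>+x. indicator A (f x) * (\<integral>\<^sup>+y. indicator C (f x + y) \<partial>lborel) \<partial>lborel)"
  proof (intro nn_integral_cong arg_cong2[where f = "(*)"] refl)
    fix x
    have "(\<integral>\<^sup>+y. indicator C (f x + y) \<partial>lborel) = emeasure lborel ((\<lambda>y. f x + y) -` C)"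
      using measurable_sets_borel[of "\<lambda>y. f x + y" borel C]
      by (subst nn_integral_indicator[symmetric]) (auto simp: indicator_def intro!: nn_integral_cong simp del: nn_integral_indicator)
    then show "emeasure lborel C = (\<integral>\<^sup>+y. indicator C (f x + y) \<partial>lborel)"
      by (simp add: emeasure_lborel_translation)
  qed
  also have "\<dots> = (\<integral>\<^sup>+x. \<integral>\<^sup>+y. indicator A (f x) * indicator C (f x + y) \<partial>lborel \<partial>lborel)"
    by (intro nn_integral_cong nn_integral_cmult[symmetric]) measurable
  also have "\<dots> = (\<integral>\<^sup>+y. \<integral>\<^sup>+x. indicator A (f x) * indicator C (f x + y) \<partial>lborel \<partial>lborel)"
    by (rule lborel_pair.Fubini') measurable
  also have "\<dots> = (\<integral>\<^sup>+y. \<integral>\<^sup>+x. indicator A (f x - y) * indicator C (f x) \<partial>lborel \<partial>lborel)"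
  proof (rule nn_integral_cong)
    fix y
    \<comment> \<open>Surjectivity moves the shift by \<open>y\<close> in the image to a shift by
      \<open>z\<close> in the domain, where translation invariance applies.\<close>
    obtain z where z: "f z = y" using orthogonal_transformation_surj[OF f] by (metis surjD)
    have "(\<integral>\<^sup>+x. indicator A (f x - y) * indicator C (f x) \<partial>lborel)
        = (\<integral>\<^sup>+x. indicator A (f x - y) * indicator C (f x) \<partial>distr lborel borel (\<lambda>x. z + x))"
      using lborel_affine[of 1 z] by (simp add: density_1)
    also have "\<dots> = (\<integral>\<^sup>+x. indicator A (f (z + x) - y) * indicator C (f (z + x)) \<partial>lborel)"
      by (subst nn_integral_distr) auto
    also have "\<dots> = (\<integral>\<^sup>+x. indicator A (f x) * indicator C (f x + y) \<partial>lborel)"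
      by (simp add: linear_add[OF lin] z add.commute)
    finally show "(\<integral>\<^sup>+x. indicator A (f x) * indicator C (f x + y) \<partial>lborel)
        = (\<integral>\<^sup>+x. indicator A (f x - y) * indicator C (f x) \<partial>lborel)" by simp
  qed
  also have "\<dots> = (\<integral>\<^sup>+x. \<integral>\<^sup>+y. indicator A (f x - y) * indicator C (f x) \<partial>lborel \<partial>lborel)"
    by (rule lborel_pair.Fubini') measurable
  also have "\<dots> = (\<integral>\<^sup>+x. (\<integral>\<^sup>+y. indicator A (f x - y) \<partial>lborel) * indicator C (f x) \<partial>lborel)"
    by (intro nn_integral_cong nn_integral_multc) measurable
  also have "\<dots> = (\<integral>\<^sup>+x. emeasure lborel A * indicator C (f x) \<partial>lborel)"
  proof (intro nn_integral_cong arg_cong2[where f = "(*)"] refl)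
    fix x
    have "(\<integral>\<^sup>+y. indicator A (f x - y) \<partial>lborel) = emeasure lborel ((\<lambda>y. f x - y) -` A)"
      using measurable_sets_borel[of "\<lambda>y. f x - y" borel A]
      by (subst nn_integral_indicator[symmetric]) (auto simp: indicator_def intro!: nn_integral_cong simp del: nn_integral_indicator)
    then show "(\<integral>\<^sup>+y. indicator A (f x - y) \<partial>lborel) = emeasure lborel A"
      by (simp add: emeasure_lborel_reflection A)
  qed
  also have "\<dots> = emeasure lborel A * emeasure lborel C"
  proof (subst nn_integral_cmult)
    have "(\<integral>\<^sup>+x. indicator C (f x) \<partial>lborel) = (\<integral>\<^sup>+x. indicator (f -` C) x \<partial>lborel)"
      by (intro nn_integral_cong) (auto simp: indicator_def)
    then show "emeasure lborel A * (\<integral>\<^sup>+x. indicator C (f x) \<partial>lborel) = emeasure lborel A * emeasure lborel C"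
      by (simp add: fC)
  qed measurable
  finally have "emeasure lborel (f -` A) * emeasure lborel C = emeasure lborel A * emeasure lborel C" .
  moreover have "emeasure lborel C \<noteq> 0" "emeasure lborel C \<noteq> top"
    by (simp_all add: C_def emeasure_cball ennreal_eq_0_iff not_le)
  ultimately show ?thesis by (simp add: mult.commute[of _ "emeasure lborel C"] ennreal_mult_cancel_left)
qed

section \<open>Measure of slabs of the sphere\<close>

text \<open>At height \<open>y\<close> the shell is an annulus with squared radii
  \<open>r\<^sup>2 - y\<^sup>2\<close> and \<open>1 - y\<^sup>2\<close>. For
  \<open>r\<^sup>2 \<le> y\<^sup>2\<close> there is no hole; \<open>max 0\<close> then makes its
  term vanish, because \<open>card A\<close> is positive.\<close>

lemma emeasure_PiM_shell_slice_le:
  fixes A :: "'i set"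
  assumes A: "finite A" "A \<noteq> {}" and y: "y\<^sup>2 < 1" and r: "0 \<le> r" "r \<le> 1"
  shows "emeasure (Pi\<^sub>M A (\<lambda>_. lborel)) ({f. r\<^sup>2 < y\<^sup>2 + (\<Sum>i\<in>A. (f i)\<^sup>2) \<and> y\<^sup>2 + (\<Sum>i\<in>A. (f i)\<^sup>2) \<le> 1} \<inter> space (Pi\<^sub>M A (\<lambda>_. lborel)))
    \<le> ennreal (unit_ball_vol (card A) * (sqrt (1 - y\<^sup>2) ^ card A - sqrt (max 0 (r\<^sup>2 - y\<^sup>2)) ^ card A))"
    (is "emeasure ?M ?S \<le> _")
proof -
  define B where "B \<rho> = {f. sqrt (\<Sum>i\<in>A. (f i)\<^sup>2) \<le> \<rho>} \<inter> space ?M" for \<rho>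
  have B: "emeasure ?M (B \<rho>) = ennreal (unit_ball_vol (card A) * \<rho> ^ card A)" if "\<rho> > 0" for \<rho>
    unfolding B_def using emeasure_cball_aux[OF A(1) that] .
  have Bm: "B \<rho> \<in> sets ?M" for \<rho>
    unfolding B_def using A(1) by measurable
  have nn: "0 \<le> (\<Sum>i\<in>A. (f i)\<^sup>2)" for f :: "'i \<Rightarrow> real" by (intro sum_nonneg) auto
  have y1: "0 < sqrt (1 - y\<^sup>2)" using y by simp
  show ?thesis
  proof (cases "y\<^sup>2 < r\<^sup>2")
    case True
    then have pos: "0 < sqrt (r\<^sup>2 - y\<^sup>2)" by simp
    have le: "sqrt (r\<^sup>2 - y\<^sup>2) \<le> sqrt (1 - y\<^sup>2)" using r by (simp add: power_le_one)
    have "?S \<subseteq> B (sqrt (1 - y\<^sup>2)) - B (sqrt (r\<^sup>2 - y\<^sup>2))"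
      using nn by (auto simp: B_def)
    then have "emeasure ?M ?S \<le> emeasure ?M (B (sqrt (1 - y\<^sup>2)) - B (sqrt (r\<^sup>2 - y\<^sup>2)))"
      by (intro emeasure_mono sets.Diff Bm)
    also have "\<dots> = emeasure ?M (B (sqrt (1 - y\<^sup>2))) - emeasure ?M (B (sqrt (r\<^sup>2 - y\<^sup>2)))"
      using le B[OF pos] by (intro emeasure_Diff Bm) (auto simp: B_def)
    also have "\<dots> = ennreal (unit_ball_vol (card A) * sqrt (1 - y\<^sup>2) ^ card A
        - unit_ball_vol (card A) * sqrt (r\<^sup>2 - y\<^sup>2) ^ card A)"
      unfolding B[OF pos] B[OF y1] using pos by (intro ennreal_minus) auto
    finally show ?thesis using True by (simp add: algebra_simps max_def)
  next
    case False
    have "?S \<subseteq> B (sqrt (1 - y\<^sup>2))" using nn by (auto simp: B_def)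
    then have "emeasure ?M ?S \<le> emeasure ?M (B (sqrt (1 - y\<^sup>2)))" by (intro emeasure_mono Bm)
    moreover have "card A > 0" using A by (simp add: card_gt_0_iff)
    then have "sqrt (max 0 (r\<^sup>2 - y\<^sup>2)) ^ card A = 0"
      using False by (simp add: max_def)
    ultimately show ?thesis unfolding B[OF y1] by (simp only: diff_zero)
  qed
qed

text \<open>Cavalieri's principle along \<open>b\<close>: an interval of heights of length
  \<open>2 * k\<close>, times a uniform bound for the slices. \<open>K\<close> stays a parameter
  because it is linear in the thickness of a thin shell when \<open>d \<ge> 2\<close>, but is taken
  to be 1, with the full disc, when \<open>d = 1\<close>.\<close>

lemma emeasure_shell_slab_Basis_le:
  fixes b :: "'a :: euclidean_space"
  assumes d: "DIM('a) = d + 1" "d \<ge> 1" and b: "b \<in> Basis" and r: "0 \<le> r" "r \<le> 1" and k: "0 \<le> k"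
    and K: "\<And>t. t\<^sup>2 < 1 \<Longrightarrow> sqrt (1 - t\<^sup>2) ^ d - sqrt (max 0 (r\<^sup>2 - t\<^sup>2)) ^ d \<le> K" "0 \<le> K"
  shows "emeasure lborel {y :: 'a. \<bar>y \<bullet> b - s\<bar> \<le> k \<and> r < norm y \<and> norm y \<le> 1}
    \<le> ennreal (2 * k * (unit_ball_vol d * K))"
proof -
  interpret product_sigma_finite "\<lambda>_ :: 'a. lborel :: real measure" by standard
  define A where "A = Basis - {b}"
  have A: "finite A" "b \<notin> A" "Basis = insert b A" using b by (auto simp: A_def)
  have cA: "card A = d" using d b by (simp add: A_def)
  have A0: "A \<noteq> {}" using cA d by auto
  let ?M = "Pi\<^sub>M Basis (\<lambda>_. lborel :: real measure)"
  let ?N = "Pi\<^sub>M A (\<lambda>_. lborel :: real measure)"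
  let ?T = "\<lambda>f :: 'a \<Rightarrow> real. \<Sum>b\<in>Basis. f b *\<^sub>R b"
  let ?S = "{y :: 'a. \<bar>y \<bullet> b - s\<bar> \<le> k \<and> r < norm y \<and> norm y \<le> 1}"
  let ?S' = "{f. \<bar>f b - s\<bar> \<le> k \<and> r\<^sup>2 < (\<Sum>i\<in>Basis. (f i)\<^sup>2) \<and> (\<Sum>i\<in>Basis. (f i)\<^sup>2) \<le> 1} \<inter> space ?M"
  let ?R = "\<lambda>y. {f. r\<^sup>2 < y\<^sup>2 + (\<Sum>i\<in>A. (f i)\<^sup>2) \<and> y\<^sup>2 + (\<Sum>i\<in>A. (f i)\<^sup>2) \<le> 1} \<inter> space ?N"
  have Sm: "?S \<in> sets borel" by measurable
  have S'm: "?S' \<in> sets ?M" using b by measurable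
  have "emeasure lborel ?S = emeasure (distr ?M borel ?T) ?S" by (subst lborel_eq) simp
  also have "\<dots> = emeasure ?M (?T -` ?S \<inter> space ?M)"
    using Sm by (subst emeasure_distr) auto
  also have "?T -` ?S \<inter> space ?M = ?S'"
  proof -
    have 1: "?T f \<bullet> b = f b" for f using b by (simp add: inner_sum_left_Basis)
    have n: "norm (?T f) = sqrt (\<Sum>i\<in>Basis. (f i)\<^sup>2)" for f
      using euclidean_dist_l2[of 0 "?T f"] by (simp add: L2_set_def inner_sum_left_Basis)
    have "r < sqrt u \<longleftrightarrow> r\<^sup>2 < u" for u using r by (metis real_less_rsqrt real_sqrt_less_iff real_sqrt_unique)
    then show ?thesis by (auto simp: 1 n)
  qed
  also have "emeasure ?M ?S' = (\<integral>\<^sup>+f. indicator ?S' f \<partial>?M)" using S'm by simp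
  also have "\<dots> = (\<integral>\<^sup>+y. \<integral>\<^sup>+f. indicator ?S' (f(b := y)) \<partial>?N \<partial>lborel)"
    using S'm A unfolding A(3) by (subst product_nn_integral_insert_rev) auto
  also have "\<dots> = (\<integral>\<^sup>+y. indicator {s - k..s + k} y * emeasure ?N (?R y) \<partial>lborel)"
  proof (rule nn_integral_cong)
    fix y :: real
    have Rm: "?R y \<in> sets ?N" using A(1) by measurable
    have "(\<integral>\<^sup>+f. indicator ?S' (f(b := y)) \<partial>?N) = (\<integral>\<^sup>+f. indicator {s - k..s + k} y * indicator (?R y) f \<partial>?N)"
    proof (rule nn_integral_cong)
      fix f assume f: "f \<in> space ?N"
      have "(\<Sum>i\<in>Basis. ((f(b := y)) i)\<^sup>2) = y\<^sup>2 + (\<Sum>i\<in>A. (f i)\<^sup>2)"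
        unfolding A(3) using A(1,2) by (simp add: sum.insert) (intro sum.cong, auto)
      moreover have "f(b := y) \<in> space ?M"
        using f unfolding A(3) by (auto simp: space_PiM PiE_def extensional_def)
      ultimately show "indicator ?S' (f(b := y)) = indicator {s - k..s + k} y * (indicator (?R y) f :: ennreal)"
        using f by (auto simp: indicator_def abs_le_iff)
    qed
    also have "\<dots> = indicator {s - k..s + k} y * emeasure ?N (?R y)"
      using Rm by (subst nn_integral_cmult) auto
    finally show "(\<integral>\<^sup>+f. indicator ?S' (f(b := y)) \<partial>?N) = indicator {s - k..s + k} y * emeasure ?N (?R y)" .
  qed
  also have "\<dots> \<le> (\<integral>\<^sup>+y. indicator {s - k..s + k} y * ennreal (unit_ball_vol d * K) \<partial>lborel)"
  proof (rule nn_integral_mono_AE)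
    \<comment> \<open>The slice bound requires \<open>y\<^sup>2 < 1\<close>, and for
      \<open>y\<^sup>2 > 1\<close> the slices are empty; the two boundary heights are a null
      set.\<close>
    have "AE y in lborel. y \<notin> {-1, 1 :: real}"
      by (intro AE_not_in countable_imp_null_set_lborel) auto
    then show "AE y in lborel. indicator {s - k..s + k} y * emeasure ?N (?R y)
      \<le> indicator {s - k..s + k} y * ennreal (unit_ball_vol d * K)"
    proof eventually_elim
      case (elim y)
      have "emeasure ?N (?R y) \<le> ennreal (unit_ball_vol d * K)"
      proof (cases "y\<^sup>2 < 1")
        case True
        have "emeasure ?N (?R y) \<le> ennreal (unit_ball_vol d * (sqrt (1 - y\<^sup>2) ^ d - sqrt (max 0 (r\<^sup>2 - y\<^sup>2)) ^ d))"
          using emeasure_PiM_shell_slice_le[OF A(1) A0 True r] unfolding cA .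
        also have "\<dots> \<le> ennreal (unit_ball_vol d * K)"
          by (intro ennreal_leI mult_left_mono K(1) True) simp
        finally show ?thesis .
      next
        case False
        have "y\<^sup>2 \<noteq> 1" using elim by (simp add: power2_eq_1_iff)
        with False have "1 < y\<^sup>2" by simp
        then have "\<not> y\<^sup>2 + (\<Sum>i\<in>A. (f i)\<^sup>2) \<le> 1" for f :: "'a \<Rightarrow> real"
          using sum_nonneg[of A "\<lambda>i. (f i)\<^sup>2"] by simp
        then have "?R y = {}" by blast
        then show ?thesis by simp
      qed
      then show ?case by (intro mult_left_mono) auto
    qed
  qed
  also have "\<dots> = ennreal (unit_ball_vol d * K) * ennreal (2 * k)"
    using k by (subst nn_integral_multc) (auto simp: mult.commute)
  also have "\<dots> = ennreal (2 * k * (unit_ball_vol d * K))"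
    using k K by (simp add: ennreal_mult'[symmetric] mult_ac)
  finally show ?thesis .
qed

text \<open>An orthogonal map taking \<open>x\<close> to a basis vector reduces this to the
  coordinate case.\<close>

lemma emeasure_shell_slab_le:
  fixes x :: "real ^ 'n"
  assumes d: "CARD('n) = d + 1" "d \<ge> 1" and x: "norm x = 1" and r: "0 \<le> r" "r \<le> 1" and k: "0 \<le> k"
    and K: "\<And>t. t\<^sup>2 < 1 \<Longrightarrow> sqrt (1 - t\<^sup>2) ^ d - sqrt (max 0 (r\<^sup>2 - t\<^sup>2)) ^ d \<le> K" "0 \<le> K"
  shows "emeasure lborel {y. \<bar>y \<bullet> x - s\<bar> \<le> k \<and> r < norm y \<and> norm y \<le> 1}
    \<le> ennreal (2 * k * (unit_ball_vol d * K))"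
proof -
  obtain b :: "real ^ 'n" where b: "b \<in> Basis" using nonempty_Basis by blast
  obtain f where f: "orthogonal_transformation f" "f x = b"
    by (rule orthogonal_transformation_exists_1[OF x norm_Basis[OF b]]) blast
  let ?S = "{y. \<bar>y \<bullet> b - s\<bar> \<le> k \<and> r < norm y \<and> norm y \<le> 1}"
  have "f y \<bullet> b = y \<bullet> x" for y
    using f unfolding orthogonal_transformation_def by metis
  then have "{y. \<bar>y \<bullet> x - s\<bar> \<le> k \<and> r < norm y \<and> norm y \<le> 1} = f -` ?S"
    using f(1) by (auto simp: orthogonal_transformation_norm)
  then have "emeasure lborel {y. \<bar>y \<bullet> x - s\<bar> \<le> k \<and> r < norm y \<and> norm y \<le> 1} = emeasure lborel ?S"
    using emeasure_lborel_orthogonal_vimage[OF f(1), of ?S] by simp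
  then show ?thesis
    using emeasure_shell_slab_Basis_le[of d b r k K s] b d r k K by simp
qed

text \<open>With \<open>x = d/2 + 1\<close> the ratio of the volumes is
  \<open>Gamma (x + 1/2) / (sqrt pi * Gamma x)\<close>, and log-convexity of Gamma at the midpoint
  of \<open>x\<close> and \<open>x + 1\<close> gives
  \<open>(Gamma (x + 1/2))\<^sup>2 \<le> x * (Gamma x)\<^sup>2\<close>. This is the origin of
  \<open>sqrt d\<close> in the measure of slabs.\<close>

lemma unit_ball_vol_le_sqrt_Suc:
  assumes "d \<ge> 1"
  shows "unit_ball_vol (real d) \<le> sqrt (real d) * unit_ball_vol (real (d + 1))"
proof -
  define x where "x = real d / 2 + 1"
  have x: "x > 0" by (simp add: x_def add_pos_nonneg)
  have G: "Gamma x > 0" "Gamma (x + 1/2) > 0" "Gamma (x + 1) > 0" using x by (auto intro: Gamma_real_pos)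
  have "(ln \<circ> Gamma) ((1 - 1/2) *\<^sub>R x + (1/2) *\<^sub>R (x + 1)) \<le> (1 - 1/2) * (ln \<circ> Gamma) x + (1/2) * (ln \<circ> Gamma) (x + 1)"
    by (rule convex_onD[OF log_convex_Gamma_real]) (use x in simp_all)
  then have "ln (Gamma (x + 1/2)) \<le> (ln (Gamma x) + ln (Gamma (x + 1))) / 2"
    by (simp add: field_simps)
  then have "ln ((Gamma (x + 1/2))\<^sup>2) \<le> ln (Gamma x * Gamma (x + 1))"
    using G by (simp add: ln_mult ln_realpow)
  then have "(Gamma (x + 1/2))\<^sup>2 \<le> Gamma x * Gamma (x + 1)" using G by simp
  also have "Gamma (x + 1) = x * Gamma x" using x by (intro Gamma_plus1) (auto elim!: nonpos_Ints_cases)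
  finally have "(Gamma (x + 1/2))\<^sup>2 \<le> x * (Gamma x)\<^sup>2" by (simp add: power2_eq_square mult_ac)
  also have "\<dots> \<le> (real d * pi) * (Gamma x)\<^sup>2"
  proof (rule mult_right_mono)
    have "x \<le> real d * 2" using assms by (simp add: x_def)
    also have "\<dots> \<le> real d * pi" using pi_ge_two by (intro mult_left_mono) auto
    finally show "x \<le> real d * pi" .
  qed simp
  finally have sq: "(Gamma (x + 1/2))\<^sup>2 \<le> real d * pi * (Gamma x)\<^sup>2" .
  have "Gamma (x + 1/2) \<le> sqrt (real d) * sqrt pi * Gamma x"
  proof (rule power2_le_imp_le[rotated])
    show "0 \<le> sqrt (real d) * sqrt pi * Gamma x" using G by simp
  qed (use sq in \<open>simp add: power_mult_distrib\<close>)
  then have "pi powr (d / 2) * Gamma (x + 1/2) \<le> pi powr (d / 2) * (sqrt (real d) * sqrt pi * Gamma x)"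
    by (intro mult_left_mono) auto
  then have "pi powr (d / 2) / Gamma x \<le> sqrt (real d) * (pi powr (d / 2) * sqrt pi / Gamma (x + 1/2))"
    using G by (simp add: field_simps)
  moreover have "pi powr (d / 2) * sqrt pi = pi powr (real (d + 1) / 2)"
    by (simp add: powr_half_sqrt[symmetric] powr_add[symmetric] add_divide_distrib add.commute)
  moreover have "x + 1/2 = real (d + 1) / 2 + 1" by (simp add: x_def field_simps)
  ultimately show ?thesis unfolding unit_ball_vol_def x_def by simp
qed

text \<open>The measure is defined by cones in the unit ball. Removing the cone scaled by
  \<open>r\<close>, whose volume is smaller by the factor \<open>r ^ (d + 1)\<close>, leaves the
  part of a shell over \<open>A\<close>. So the measure can be read off in arbitrarily thin shells,
  where \<open>y\<close> and \<open>sgn y\<close> are close.\<close>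

lemma measure_sphere_borel_shell:
  fixes A :: "(real ^ 'n) set"
  assumes A: "A \<in> sets borel" "A \<subseteq> sphere 0 1" and r: "0 \<le> r" "r < 1" and d: "CARD('n) = d + 1"
  shows "measure sphere_borel_measure A * (unit_ball_vol (real (d + 1)) * (1 - r ^ (d + 1)))
    = measure lborel {y. r < norm y \<and> norm y \<le> 1 \<and> sgn y \<in> A}"
proof -
  define S where "S \<rho> = {y. 0 < norm y \<and> norm y \<le> \<rho> \<and> sgn y \<in> A}" for \<rho>
  note [measurable] = A(1)
  have Sm: "S \<rho> \<in> sets borel" for \<rho>
    unfolding S_def by measurable
  have fm: "S \<rho> \<in> fmeasurable lborel" for \<rho>
  proof (rule fmeasurableI2[of "cball 0 \<rho>"])
    show "cball (0 :: real ^ 'n) \<rho> \<in> fmeasurable lborel"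
      by (intro fmeasurableI emeasure_lborel_cball_finite) auto
  qed (use Sm in \<open>auto simp: S_def\<close>)
  have "S 1 = {t *\<^sub>R a | t a. 0 < t \<and> t \<le> 1 \<and> a \<in> A}" (is "_ = ?R")
  proof (intro equalityI subsetI)
    fix y assume "y \<in> S 1"
    then show "y \<in> ?R"
      by (intro CollectI exI[of _ "norm y"] exI[of _ "sgn y"]) (auto simp: S_def sgn_div_norm)
  next
    fix y assume "y \<in> ?R"
    then obtain t a where ta: "y = t *\<^sub>R a" "0 < t" "t \<le> 1" "a \<in> A" by auto
    then have "norm a = 1" using A(2) by auto
    with ta show "y \<in> S 1" by (auto simp: S_def sgn_div_norm)
  qed
  then have e: "emeasure sphere_borel_measure A = emeasure lborel (S 1) / emeasure lborel (cball (0 :: real ^ 'n) 1)"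
    using emeasure_sphere_borel_measure[OF A] by simp
  have V: "emeasure lborel (cball (0 :: real ^ 'n) 1) = ennreal (unit_ball_vol (real (d + 1)))"
    by (simp add: emeasure_cball d)
  have S1: "emeasure lborel (S 1) = ennreal (measure lborel (S 1))"
    by (rule emeasure_eq_measure2[OF fm])
  have "emeasure sphere_borel_measure A = ennreal (measure lborel (S 1) / unit_ball_vol (real (d + 1)))"
    unfolding e V by (subst S1) (intro divide_ennreal, auto)
  then have "measure sphere_borel_measure A = measure lborel (S 1) / unit_ball_vol (real (d + 1))"
    by (intro measure_eq_emeasure_eq_ennreal) auto
  then have m1: "measure sphere_borel_measure A * unit_ball_vol (real (d + 1)) = measure lborel (S 1)"
    by (simp add: less_imp_neq[OF unit_ball_vol_pos, symmetric])
  have mr: "measure lborel (S r) = r ^ (d + 1) * measure lborel (S 1)"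
  proof (cases "r = 0")
    case True
    have "S 0 = {}" by (auto simp: S_def)
    then show ?thesis using True by simp
  next
    case False
    with r have r0: "r > 0" by simp
    have "emeasure lborel (S r) = emeasure (density (distr lborel borel (\<lambda>x. 0 + r *\<^sub>R x)) (\<lambda>_. \<bar>r\<bar> ^ DIM(real ^ 'n))) (S r)"
      using lborel_affine[of r "0 :: real ^ 'n"] r0 by simp
    also have "\<dots> = ennreal (r ^ (d + 1)) * emeasure lborel ((\<lambda>x. r *\<^sub>R x) -` S r)"
      using Sm[of r] r0 by (simp add: emeasure_density_const emeasure_distr d)
    also have "(\<lambda>x. r *\<^sub>R x) -` S r = S 1"
      using r0 by (auto simp: S_def sgn_scaleR field_simps)
    finally show ?thesis using r0 by (simp add: measure_def enn2real_mult)
  qed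
  have "{y. r < norm y \<and> norm y \<le> 1 \<and> sgn y \<in> A} = S 1 - S r"
    using r by (auto simp: S_def)
  also have "measure lborel \<dots> = measure lborel (S 1) - measure lborel (S r)"
    using r by (intro measurable_measure_Diff fm) (auto simp: S_def Sm)
  finally show ?thesis using m1 mr by (simp add: algebra_simps)
qed

text \<open>The set is thickened radially to a shell of thickness \<open>\<epsilon> \<le> h\<close>,
  where it stays in a slab of half-width \<open>2 * h\<close>. The bound for the volume of this slab
  and that for the shell are both linear in \<open>\<epsilon>\<close>, so \<open>\<epsilon>\<close>
  cancels and the ratio \<open>V / W\<close> remains.\<close>

lemma measure_sphere_slab_le:
  fixes x :: "real ^ 'n"
  assumes d: "CARD('n) = d + 1" "d \<ge> 2" and x: "norm x = 1" and h: "0 < h"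
  shows "measure sphere_borel_measure {y \<in> sphere 0 1. \<bar>y \<bullet> x - s\<bar> \<le> h} \<le> 16 * h * sqrt (real d)"
proof -
  define A where "A = {y \<in> sphere 0 1. \<bar>y \<bullet> x - s\<bar> \<le> h}"
  have "A = {y. norm y = 1 \<and> \<bar>y \<bullet> x - s\<bar> \<le> h}" by (auto simp: A_def)
  also have "\<dots> \<in> sets borel" by measurable
  finally have A: "A \<in> sets borel" "A \<subseteq> sphere 0 1" by (auto simp: A_def)
  \<comment> \<open>\<open>\<epsilon> \<le> h\<close> keeps the radial displacement below
    \<open>h\<close>; \<open>\<epsilon> * (d + 1) \<le> 1\<close> is the range in which
    \<open>D\<close> is shown to be at least half of its linearization.\<close>
  define \<epsilon> where "\<epsilon> = min h (1 / (real d + 1))"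
  have \<epsilon>: "0 < \<epsilon>" "\<epsilon> \<le> h" "\<epsilon> * (real d + 1) \<le> 1" "\<epsilon> < 1"
  proof -
    show "0 < \<epsilon>" "\<epsilon> \<le> h" using h by (auto simp: \<epsilon>_def add_pos_nonneg)
    have "\<epsilon> \<le> 1 / (real d + 1)" by (simp add: \<epsilon>_def)
    then show *: "\<epsilon> * (real d + 1) \<le> 1" by (simp add: field_simps)
    show "\<epsilon> < 1" using d by (auto simp: \<epsilon>_def min_less_iff_disj)
  qed
  define V W where "V = unit_ball_vol (real d)" and "W = unit_ball_vol (real (d + 1))"
  have V: "V > 0" "W > 0" "V \<le> sqrt (real d) * W"
    using unit_ball_vol_le_sqrt_Suc[of d] d by (simp_all add: V_def W_def)
  define r where "r = 1 - \<epsilon>"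
  have r: "0 \<le> r" "r < 1" using \<epsilon> by (auto simp: r_def)
  define D where "D = 1 - r ^ (d + 1)"
  have D: "\<epsilon> * (real d + 1) / 2 \<le> D"
  proof -
    define z where "z = \<epsilon> * (real d + 1)"
    have z: "0 < z" "z \<le> 1" using \<epsilon> by (auto simp: z_def add_pos_nonneg)
    \<comment> \<open>Bernoulli's inequality for \<open>1 + \<epsilon>\<close> is transferred to
      \<open>r\<close> by \<open>(1 - \<epsilon>) * (1 + \<epsilon>) \<le> 1\<close>: this gives
      \<open>r ^ (d + 1) \<le> 1 / (1 + z) \<le> 1 - z / 2\<close>.\<close>
    have "1 + z \<le> (1 + \<epsilon>) ^ (d + 1)"
      using Bernoulli_inequality[of \<epsilon> "d + 1"] \<epsilon> by (simp add: z_def mult.commute add.commute)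
    then have "r ^ (d + 1) * (1 + z) \<le> r ^ (d + 1) * (1 + \<epsilon>) ^ (d + 1)"
      using r by (intro mult_left_mono) auto
    also have "\<dots> = (1 - \<epsilon>\<^sup>2) ^ (d + 1)"
      unfolding power_mult_distrib[symmetric] by (simp add: r_def algebra_simps power2_eq_square)
    also have "\<dots> \<le> 1" using \<epsilon> by (intro power_le_one) (auto simp: power_le_one)
    also have "1 \<le> (1 - z / 2) * (1 + z)" using z by (simp add: algebra_simps)
    finally have "r ^ (d + 1) \<le> 1 - z / 2" using z by (simp only: mult_le_cancel_right_pos)
    then show ?thesis by (simp add: D_def z_def)
  qed
  have K: "sqrt (1 - t\<^sup>2) ^ d - sqrt (max 0 (r\<^sup>2 - t\<^sup>2)) ^ d \<le> 2 * real d * \<epsilon>" if t: "t\<^sup>2 < 1" for t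
  proof -
    define a b where "a = sqrt (1 - t\<^sup>2)" and "b = sqrt (max 0 (r\<^sup>2 - t\<^sup>2))"
    have r2: "r\<^sup>2 \<le> 1" using r by (simp add: power_le_one)
    have ab: "0 \<le> b" "b \<le> a" "0 \<le> a" "a \<le> 1" using t r2 by (auto simp: a_def b_def)
    define d' where "d' = d - 2"
    have d': "d = Suc (Suc d')" using d by (simp add: d'_def)
    have "a ^ d - b ^ d \<le> real d * (a - b) * a ^ Suc d'"
      using power_Suc_diff_le[OF ab(1,2), of "Suc d'"] d' by simp
    \<comment> \<open>Here \<open>d \<ge> 2\<close> matters: the spare factor \<open>a\<close> turns
      \<open>a - b\<close>, a difference of roots that need not be linear in
      \<open>\<epsilon>\<close>, into \<open>a\<^sup>2 - b\<^sup>2\<close>, which is at most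
      \<open>2 * \<epsilon>\<close>.\<close>
    also have "a ^ Suc d' \<le> a + b"
      using mult_left_le[of "a ^ d'" a] ab power_le_one[of a d'] by simp
    then have "real d * (a - b) * a ^ Suc d' \<le> real d * (a - b) * (a + b)"
      using ab by (intro mult_left_mono) auto
    also have "\<dots> = real d * (a\<^sup>2 - b\<^sup>2)" by (simp add: algebra_simps power2_eq_square)
    also have "a\<^sup>2 - b\<^sup>2 \<le> 2 * \<epsilon>"
    proof -
      have "a\<^sup>2 = 1 - t\<^sup>2" "b\<^sup>2 \<ge> r\<^sup>2 - t\<^sup>2" using t by (simp_all add: a_def b_def)
      moreover have "1 - r\<^sup>2 \<le> 2 * \<epsilon>" by (simp add: r_def power2_eq_square algebra_simps)
      ultimately show ?thesis by linarith
    qed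
    then have "real d * (a\<^sup>2 - b\<^sup>2) \<le> real d * (2 * \<epsilon>)" by (intro mult_left_mono) auto
    finally show ?thesis by (simp add: a_def b_def mult_ac)
  qed
  have sub: "{y. r < norm y \<and> norm y \<le> 1 \<and> sgn y \<in> A} \<subseteq> {y. \<bar>y \<bullet> x - s\<bar> \<le> 2 * h \<and> r < norm y \<and> norm y \<le> 1}"
  proof safe
    fix y assume y: "r < norm y" "norm y \<le> 1" "sgn y \<in> A"
    have "y - sgn y = (norm y - 1) *\<^sub>R sgn y" by (cases "y = 0") (simp_all add: sgn_div_norm algebra_simps)
    then have "\<bar>y \<bullet> x - sgn y \<bullet> x\<bar> = \<bar>norm y - 1\<bar> * \<bar>sgn y \<bullet> x\<bar>"
      by (metis abs_mult inner_diff_left inner_scaleR_left)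
    also have "\<dots> \<le> \<epsilon> * 1"
    proof (intro mult_mono)
      show "\<bar>norm y - 1\<bar> \<le> \<epsilon>" using y by (simp add: r_def)
      show "\<bar>sgn y \<bullet> x\<bar> \<le> 1"
        using Cauchy_Schwarz_ineq2[of "sgn y" x] x y(3) A(2) by auto
    qed (use \<epsilon> in auto)
    finally show "\<bar>y \<bullet> x - s\<bar> \<le> 2 * h" using y(3) \<epsilon> unfolding A_def by force
  qed
  have em: "emeasure lborel {y. \<bar>y \<bullet> x - s\<bar> \<le> 2 * h \<and> r < norm y \<and> norm y \<le> 1} \<le> ennreal (2 * (2 * h) * (V * (2 * real d * \<epsilon>)))"
    unfolding V_def using emeasure_shell_slab_le[of d x r "2 * h" "2 * real d * \<epsilon>" s] d x r h \<epsilon> K by simp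
  have "measure sphere_borel_measure A * (W * D) = measure lborel {y. r < norm y \<and> norm y \<le> 1 \<and> sgn y \<in> A}"
    using measure_sphere_borel_shell[OF A r d(1)] by (simp add: W_def D_def)
  also have "\<dots> \<le> 2 * (2 * h) * (V * (2 * real d * \<epsilon>))"
  proof -
    have "emeasure lborel {y. r < norm y \<and> norm y \<le> 1 \<and> sgn y \<in> A} \<le> ennreal (2 * (2 * h) * (V * (2 * real d * \<epsilon>)))"
      by (rule order_trans[OF emeasure_mono[OF sub] em]) measurable
    then show ?thesis
      unfolding measure_def using V h \<epsilon> by (intro enn2real_leI) auto
  qed
  also have "\<dots> \<le> (16 * h * sqrt (real d)) * (W * (\<epsilon> * (real d + 1) / 2))"
  proof -
    have "2 * (2 * h) * (V * (2 * real d * \<epsilon>)) \<le> 2 * (2 * h) * ((sqrt (real d) * W) * (2 * (real d + 1) * \<epsilon>))"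
      using V h \<epsilon> by (intro mult_left_mono mult_mono) auto
    also have "\<dots> = (16 * h * sqrt (real d)) * (W * (\<epsilon> * (real d + 1) / 2))" by (simp add: field_simps)
    finally show ?thesis .
  qed
  also have "\<dots> \<le> (16 * h * sqrt (real d)) * (W * D)"
    using D V h by (intro mult_left_mono) auto
  finally have "measure sphere_borel_measure A * (W * D) \<le> (16 * h * sqrt (real d)) * (W * D)" .
  moreover have "0 < W * D"
  proof (intro mult_pos_pos V)
    have "0 < \<epsilon> * (real d + 1)" using \<epsilon> by (intro mult_pos_pos) auto
    then show "0 < D" using D by linarith
  qed
  ultimately show ?thesis unfolding A_def[symmetric] by (simp only: mult_le_cancel_right_pos)
qed

text \<open>A slab through the centre is closed under shrinking towards the origin. The cone over
  the set thus stays in the slab, and the full disc, \<open>r = 0\<close>, takes the place of a thin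
  shell.\<close>

lemma measure_circle_slab_le:
  fixes e :: "real ^ 'n"
  assumes d: "CARD('n) = 2" and e: "norm e = 1" and h: "0 < h"
  shows "measure sphere_borel_measure {y \<in> sphere 0 1. \<bar>y \<bullet> e\<bar> \<le> h} \<le> 2 * h"
proof -
  define A where "A = {y \<in> sphere 0 1. \<bar>y \<bullet> e\<bar> \<le> h}"
  have "A = {y. norm y = 1 \<and> \<bar>y \<bullet> e\<bar> \<le> h}" by (auto simp: A_def)
  also have "\<dots> \<in> sets borel" by measurable
  finally have A: "A \<in> sets borel" "A \<subseteq> sphere 0 1" by (auto simp: A_def)
  define V W where "V = unit_ball_vol (real 1)" and "W = unit_ball_vol (real (1 + 1))"
  have V: "V > 0" "W > 0" "V \<le> W"
    using unit_ball_vol_le_sqrt_Suc[of 1] unfolding V_def W_def by simp_all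
  have sub: "{y. 0 < norm y \<and> norm y \<le> 1 \<and> sgn y \<in> A} \<subseteq> {y. \<bar>y \<bullet> e - 0\<bar> \<le> h \<and> 0 < norm y \<and> norm y \<le> 1}"
  proof clarsimp
    fix y assume y: "y \<noteq> 0" "norm y \<le> 1" "sgn y \<in> A"
    have "\<bar>y \<bullet> e\<bar> = norm y * \<bar>sgn y \<bullet> e\<bar>" using y by (simp add: sgn_div_norm abs_mult)
    also have "\<dots> \<le> 1 * \<bar>sgn y \<bullet> e\<bar>" using y by (intro mult_right_mono) auto
    also have "\<dots> \<le> h" using y(3) by (simp add: A_def)
    finally show "\<bar>y \<bullet> e\<bar> \<le> h" .
  qed
  have em: "emeasure lborel {y. \<bar>y \<bullet> e - 0\<bar> \<le> h \<and> 0 < norm y \<and> norm y \<le> 1} \<le> ennreal (2 * h * (V * 1))"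
    unfolding V_def using d e h by (intro emeasure_shell_slab_le) auto
  have "measure sphere_borel_measure A * (W * (1 - 0 ^ (1 + 1))) = measure lborel {y. 0 < norm y \<and> norm y \<le> 1 \<and> sgn y \<in> A}"
    unfolding W_def using A d by (intro measure_sphere_borel_shell) auto
  also have "\<dots> \<le> 2 * h * V"
  proof -
    have "emeasure lborel {y. 0 < norm y \<and> norm y \<le> 1 \<and> sgn y \<in> A} \<le> ennreal (2 * h * (V * 1))"
      by (rule order_trans[OF emeasure_mono[OF sub] em]) measurable
    then show ?thesis
      unfolding measure_def using V h by (intro enn2real_leI) auto
  qed
  also have "\<dots> \<le> 2 * h * W" using V h by (intro mult_left_mono) auto
  finally have "measure sphere_borel_measure A * W \<le> (2 * h) * W" by simp
  then show ?thesis unfolding A_def[symmetric] using V by (simp only: mult_le_cancel_right_pos)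
qed

text \<open>
  For \<open>d = 1\<close> the law of \<open>x \<bullet> y\<close> has an unbounded density, so there the neighbourhood of the (at most two)
  points with \<open>x \<bullet> z = s\<close> is enclosed in slabs around diameters instead.
\<close>

lemma sphere_level_neighbourhood:
  fixes x :: "real ^ 'n"
  assumes d: "CARD('n) = d + 1" "d \<ge> 1" and x: "norm x = 1" and h: "0 < h"
  shows "\<exists>A\<in>sets borel. A \<subseteq> sphere 0 1 \<and> measure sphere_borel_measure A \<le> 16 * h * sqrt (real d)
    \<and> (\<forall>y\<in>sphere 0 1. \<forall>z\<in>sphere 0 1. x \<bullet> z = s \<longrightarrow> dist y z \<le> h \<longrightarrow> y \<in> A)"
proof -
  have slab: "{y \<in> sphere 0 1. \<bar>y \<bullet> e - c\<bar> \<le> h} \<in> sets borel" for e :: "real ^ 'n" and c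
  proof -
    have "{y \<in> sphere 0 1. \<bar>y \<bullet> e - c\<bar> \<le> h} = {y. norm y = 1 \<and> \<bar>y \<bullet> e - c\<bar> \<le> h}" by auto
    also have "\<dots> \<in> sets borel" by measurable
    finally show ?thesis .
  qed
  have near: "\<bar>y \<bullet> e - z \<bullet> e\<bar> \<le> h" if "norm e = 1" "dist y z \<le> h" for y z e :: "real ^ 'n"
    using Cauchy_Schwarz_ineq2[of "y - z" e] that by (simp add: dist_norm inner_diff_left)
  show ?thesis
  proof (cases "d \<ge> 2")
    case True
    show ?thesis
    proof (intro bexI[OF _ slab[of x s]] conjI ballI impI)
      show "measure sphere_borel_measure {y \<in> sphere 0 1. \<bar>y \<bullet> x - s\<bar> \<le> h} \<le> 16 * h * sqrt (real d)"
        by (rule measure_sphere_slab_le[OF d(1) True x h])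
      fix y z assume "y \<in> sphere 0 1" "z \<in> sphere 0 1" "x \<bullet> z = s" "dist y z \<le> h"
      then show "y \<in> {y \<in> sphere 0 1. \<bar>y \<bullet> x - s\<bar> \<le> h}"
        using near[OF x, of y z] by (simp add: inner_commute)
    qed auto
  next
    case False
    with d have d1: "d = 1" "CARD('n) = 2" by auto
    obtain e0 :: "real ^ 'n" where e0: "e0 \<noteq> 0" "orthogonal x e0"
      using orthogonal_to_vector_exists[of x] d1 by auto
    define e where "e = e0 /\<^sub>R norm e0"
    have e: "norm e = 1" "x \<bullet> e = 0" using e0 by (auto simp: e_def orthogonal_def)
    define c where "c = sqrt (1 - s\<^sup>2)"
    \<comment> \<open>The points of the circle on the level are
      \<open>s *\<^sub>R x + c *\<^sub>R e\<close> and \<open>s *\<^sub>R x - c *\<^sub>R e\<close>.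
      When they exist, \<open>e1\<close> and \<open>e2\<close> are unit vectors orthogonal to the
      first and the second, so points near them lie in central slabs.\<close>
    define e1 e2 where "e1 = (- c) *\<^sub>R x + s *\<^sub>R e" and "e2 = c *\<^sub>R x + s *\<^sub>R e"
    define A where "A v = {y \<in> sphere 0 1. \<bar>y \<bullet> v\<bar> \<le> h}" for v :: "real ^ 'n"
    have Am: "A v \<in> sets borel" for v using slab[of v 0] by (simp add: A_def)
    have key: "norm e1 = 1 \<and> norm e2 = 1 \<and> (z \<bullet> e1 = 0 \<or> z \<bullet> e2 = 0)" if z: "norm z = 1" "x \<bullet> z = s" for z
    proof -
      define w where "w = z - s *\<^sub>R x - (z \<bullet> e) *\<^sub>R e"
      have xx: "x \<bullet> x = 1" "e \<bullet> e = 1" "e \<bullet> x = 0" using x e by (auto simp: norm_eq_1 inner_commute)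
      have w: "w \<bullet> x = 0" "w \<bullet> e = 0"
        using z xx e by (simp_all add: w_def inner_diff_left inner_diff_right inner_commute)
      have "w = 0"
      proof (rule ccontr)
        assume "w \<noteq> 0"
        have xe: "x \<noteq> e" "w \<noteq> x" "w \<noteq> e" using xx e w \<open>w \<noteq> 0\<close> by auto
        have "independent {x, e, w}"
          using w e xx \<open>w \<noteq> 0\<close> by (intro pairwise_orthogonal_independent)
            (auto simp: pairwise_def orthogonal_def inner_commute)
        then have "card {x, e, w} \<le> 2" using independent_bound[of "{x, e, w}"] d1 by simp
        then show False using xe by auto
      qed
      then have zz: "z = s *\<^sub>R x + (z \<bullet> e) *\<^sub>R e" by (simp add: w_def algebra_simps)
      have "1 = z \<bullet> z" using z by (simp add: norm_eq_1)
      also have "\<dots> = s\<^sup>2 + (z \<bullet> e)\<^sup>2"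
        by (subst (1 2) zz) (simp add: inner_add_left inner_add_right xx e power2_eq_square)
      finally have sz: "(z \<bullet> e)\<^sup>2 = 1 - s\<^sup>2" by simp
      then have c2: "c\<^sup>2 = 1 - s\<^sup>2" using zero_le_power2[of "z \<bullet> e"] by (simp add: c_def)
      have n: "norm e1 = 1" "norm e2 = 1"
        using c2 by (simp_all add: norm_eq_1 e1_def e2_def inner_add_left inner_add_right
          inner_diff_left inner_diff_right xx e power2_eq_square)
      have "z \<bullet> e = c \<or> z \<bullet> e = - c" using sz c2 by (metis power2_eq_iff)
      then have "z \<bullet> e1 = 0 \<or> z \<bullet> e2 = 0"
        using z by (auto simp: e1_def e2_def inner_add_right inner_diff_right inner_commute[of z x])
      with n show ?thesis by blast
    qed
    show ?thesis
    proof (cases "\<exists>z. norm z = 1 \<and> x \<bullet> z = s")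
      case True
      then have n: "norm e1 = 1" "norm e2 = 1" using key by auto
      interpret prob_space "sphere_borel_measure :: (real ^ 'n) measure" by (rule prob_space_sphere_borel_measure)
      have As: "A v \<in> sets sphere_borel_measure" for v
        using Am[of v] by (auto simp: sets_sphere_borel_measure sets_restrict_space_iff A_def)
      show ?thesis
      proof (intro bexI[of _ "A e1 \<union> A e2"] conjI ballI impI)
        have "measure sphere_borel_measure (A e1 \<union> A e2)
            \<le> measure sphere_borel_measure (A e1) + measure sphere_borel_measure (A e2)"
          using As by (intro measure_Un_le) auto
        also have "\<dots> \<le> 2 * h + 2 * h"
          unfolding A_def by (intro add_mono measure_circle_slab_le d1 n h)
        finally show "measure sphere_borel_measure (A e1 \<union> A e2) \<le> 16 * h * sqrt (real d)" using d1 h by simp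
        fix y z assume yz: "y \<in> sphere 0 1" "z \<in> sphere 0 1" "x \<bullet> z = s" "dist y z \<le> h"
        then have "z \<bullet> e1 = 0 \<or> z \<bullet> e2 = 0" using key by auto
        then show "y \<in> A e1 \<union> A e2"
          using near[OF n(1) yz(4)] near[OF n(2) yz(4)] yz(1) by (auto simp: A_def)
      qed (use Am in \<open>auto simp: A_def\<close>)
    next
      case False
      then show ?thesis using h by (intro bexI[of _ "{}"]) auto
    qed
  qed
qed

subsection \<open>Approximation of the integral\<close>

lemma integrable_bounded_prob:
  fixes f :: "'a \<Rightarrow> real"
  assumes "prob_space M" "f \<in> borel_measurable M" "AE y in M. \<bar>f y\<bar> \<le> c"
  shows "integrable M f"
proof -
  interpret prob_space M by fact
  show ?thesis using assms(2,3) by (intro integrable_const_bound[of f c]) auto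
qed

text \<open>
  \<open>a 1 k\<close> and \<open>a (-1) k\<close> are the integrals of the positive and the negative part of \<open>g\<close> over the
  set of points for which \<open>q k\<close> is the first point of the net within distance \<open>\<eta>\<close>.
\<close>

lemma discretize_density:
  fixes g :: "real ^ 'n \<Rightarrow> real" and q :: "nat \<Rightarrow> real ^ 'n" and \<Phi> :: "real \<Rightarrow> real"
  assumes g: "g \<in> borel_measurable sphere_measure" "AE y in sphere_measure. \<bar>g y\<bar> \<le> 1"
    and cover: "\<And>y. y \<in> sphere 0 1 \<Longrightarrow> \<exists>k<K. dist y (q k) \<le> \<eta>"
    and q: "\<And>k. k < K \<Longrightarrow> q k \<in> sphere 0 1"
    and \<Phi>: "\<And>t t'. t \<in> {-1..1} \<Longrightarrow> t' \<in> {-1..1} \<Longrightarrow> \<bar>\<Phi> t - \<Phi> t'\<bar> \<le> \<bar>t - t'\<bar>"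
  shows "\<exists>a :: real \<Rightarrow> nat \<Rightarrow> real. (\<forall>e k. 0 \<le> a e k) \<and>
    (\<forall>x\<in>sphere 0 1. \<bar>(LINT y|sphere_measure. \<Phi> (x \<bullet> y) * g y) - (\<Sum>k<K. (a 1 k - a (-1) k) * \<Phi> (x \<bullet> q k))\<bar> \<le> \<eta>) \<and>
    (\<forall>T A. T \<subseteq> {..<K} \<longrightarrow> A \<in> sets borel \<longrightarrow> A \<subseteq> sphere 0 1 \<longrightarrow>
      (\<forall>y\<in>sphere 0 1. \<forall>k\<in>T. dist y (q k) \<le> \<eta> \<longrightarrow> y \<in> A) \<longrightarrow>
      (\<Sum>k\<in>T. a 1 k + a (-1) k) \<le> measure sphere_borel_measure A)"
proof -
  let ?M = "sphere_measure :: (real ^ 'n) measure"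
  interpret prob_space ?M by (rule prob_space_sphere_measure)
  have sp: "space ?M = sphere 0 1"
    by (simp add: sphere_measure_def space_sphere_borel_measure)
  have bM: "f \<in> borel_measurable ?M" if "continuous_on (sphere 0 1) f" for f :: "real ^ 'n \<Rightarrow> real"
  proof -
    have "f \<in> borel_measurable (restrict_space borel (sphere 0 1))"
      using that by (rule borel_measurable_continuous_on_restrict)
    then have "f \<in> borel_measurable sphere_borel_measure"
      by (simp cong: measurable_cong_sets add: sets_sphere_borel_measure)
    then show ?thesis unfolding sphere_measure_def by (rule measurable_completion)
  qed
  define \<kappa> where "\<kappa> y = (LEAST k. k < K \<and> dist y (q k) \<le> \<eta>)" for y
  have \<kappa>: "\<kappa> y < K" "dist y (q (\<kappa> y)) \<le> \<eta>" if "y \<in> sphere 0 1" for y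
    using LeastI_ex[OF cover[OF that, unfolded Bex_def]] unfolding \<kappa>_def by auto
  have distm [measurable]: "(\<lambda>y. dist y (q k)) \<in> borel_measurable ?M" for k
    by (intro bM continuous_intros)
  have \<kappa>m [measurable]: "\<kappa> \<in> measurable ?M (count_space UNIV)"
    unfolding \<kappa>_def by measurable
  note [measurable] = g(1)
  define a where "a e k = (LINT y|?M. of_bool (\<kappa> y = k) * max 0 (e * g y))" for e k
  have int_a: "integrable ?M (\<lambda>y. of_bool (\<kappa> y = k) * max 0 (e * g y))" if "\<bar>e\<bar> = 1" for e k
  proof (rule integrable_bounded_prob[OF prob_space_axioms, of _ 1])
    show "AE y in ?M. \<bar>of_bool (\<kappa> y = k) * max 0 (e * g y)\<bar> \<le> 1"
      using g(2)
    proof eventually_elim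
      case (elim y)
      then have "\<bar>e * g y\<bar> \<le> 1" using that by (simp add: abs_mult)
      then have "\<bar>max 0 (e * g y)\<bar> \<le> 1" by linarith
      then show ?case by simp
    qed
  qed measurable
  have a0: "0 \<le> a e k" for e k
    unfolding a_def by (intro integral_nonneg_AE) auto
  have aminus: "a 1 k - a (-1) k = (LINT y|?M. of_bool (\<kappa> y = k) * g y)" for k
  proof -
    have "a 1 k - a (-1) k = (LINT y|?M. of_bool (\<kappa> y = k) * max 0 (1 * g y) - of_bool (\<kappa> y = k) * max 0 (-1 * g y))"
      unfolding a_def by (intro Bochner_Integration.integral_diff[symmetric] int_a) auto
    also have "\<dots> = (LINT y|?M. of_bool (\<kappa> y = k) * g y)"
      by (intro Bochner_Integration.integral_cong) (auto simp: max_def)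
    finally show ?thesis .
  qed
  have aplus: "a 1 k + a (-1) k = (LINT y|?M. of_bool (\<kappa> y = k) * \<bar>g y\<bar>)" for k
  proof -
    have "a 1 k + a (-1) k = (LINT y|?M. of_bool (\<kappa> y = k) * max 0 (1 * g y) + of_bool (\<kappa> y = k) * max 0 (-1 * g y))"
      unfolding a_def by (intro Bochner_Integration.integral_add[symmetric] int_a) auto
    also have "\<dots> = (LINT y|?M. of_bool (\<kappa> y = k) * \<bar>g y\<bar>)"
      by (intro Bochner_Integration.integral_cong) (auto simp: max_def)
    finally show ?thesis .
  qed
  have inner01: "x \<bullet> y \<in> {-1..1}" if "x \<in> sphere 0 1" "y \<in> sphere 0 1" for x y :: "real ^ 'n"
    using Cauchy_Schwarz_ineq2[of x y] that by (auto simp: abs_le_iff)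
  have int_g: "integrable ?M (\<lambda>y. of_bool (\<kappa> y = k) * g y)" for k
    using g(2) by (intro integrable_bounded_prob[OF prob_space_axioms, of _ 1]) (auto elim!: eventually_mono)
  have int_absg: "integrable ?M (\<lambda>y. of_bool (\<kappa> y = k) * \<bar>g y\<bar>)" for k
    using g(2) by (intro integrable_bounded_prob[OF prob_space_axioms, of _ 1]) (auto elim!: eventually_mono)
  have approx: "\<bar>(LINT y|?M. \<Phi> (x \<bullet> y) * g y) - (\<Sum>k<K. (a 1 k - a (-1) k) * \<Phi> (x \<bullet> q k))\<bar> \<le> \<eta>"
    if x: "x \<in> sphere 0 1" for x
  proof -
    have "continuous_on {-1..1} \<Phi>"
      unfolding continuous_on_iff dist_real_def using \<Phi> by (meson le_less_trans)
    then have "continuous_on (sphere 0 1) (\<lambda>y. \<Phi> (x \<bullet> y))"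
      using inner01[OF x] by (intro continuous_on_compose2[of "{-1..1}" \<Phi> _ "\<lambda>y. x \<bullet> y"] continuous_intros) auto
    then have \<Phi>m [measurable]: "(\<lambda>y. \<Phi> (x \<bullet> y)) \<in> borel_measurable ?M" by (rule bM)
    have \<Phi>b: "\<bar>\<Phi> t\<bar> \<le> \<bar>\<Phi> 0\<bar> + 1" if "t \<in> {-1..1}" for t
      using \<Phi>[OF that, of 0] that by auto
    have int1: "integrable ?M (\<lambda>y. \<Phi> (x \<bullet> y) * g y)"
    proof (rule integrable_bounded_prob[OF prob_space_axioms, of _ "\<bar>\<Phi> 0\<bar> + 1"])
      show "AE y in ?M. \<bar>\<Phi> (x \<bullet> y) * g y\<bar> \<le> \<bar>\<Phi> 0\<bar> + 1"
        using g(2) AE_space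
      proof eventually_elim
        case (elim y)
        then have "\<bar>\<Phi> (x \<bullet> y)\<bar> * \<bar>g y\<bar> \<le> (\<bar>\<Phi> 0\<bar> + 1) * 1"
          using \<Phi>b[OF inner01[OF x]] sp by (intro mult_mono) auto
        then show ?case by (simp add: abs_mult)
      qed
    qed measurable
    have sum_eq: "(\<Sum>k<K. of_bool (\<kappa> y = k) * g y * \<Phi> (x \<bullet> q k)) = \<Phi> (x \<bullet> q (\<kappa> y)) * g y"
      if "y \<in> space ?M" for y
    proof -
      have "(\<Sum>k<K. of_bool (\<kappa> y = k) * g y * \<Phi> (x \<bullet> q k)) = (\<Sum>k<K. if k = \<kappa> y then \<Phi> (x \<bullet> q k) * g y else 0)"
        by (intro sum.cong) auto
      then show ?thesis using \<kappa>(1)[of y] that sp by (simp add: sum.delta)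
    qed
    have int2: "integrable ?M (\<lambda>y. \<Sum>k<K. of_bool (\<kappa> y = k) * g y * \<Phi> (x \<bullet> q k))"
      by (intro Bochner_Integration.integrable_sum integrable_mult_left int_g)
    have "(\<Sum>k<K. (a 1 k - a (-1) k) * \<Phi> (x \<bullet> q k))
        = (LINT y|?M. (\<Sum>k<K. of_bool (\<kappa> y = k) * g y * \<Phi> (x \<bullet> q k)))"
      unfolding aminus by (subst Bochner_Integration.integral_sum) (auto intro!: int_g integrable_mult_left)
    then have "(LINT y|?M. \<Phi> (x \<bullet> y) * g y) - (\<Sum>k<K. (a 1 k - a (-1) k) * \<Phi> (x \<bullet> q k))
        = (LINT y|?M. \<Phi> (x \<bullet> y) * g y - (\<Sum>k<K. of_bool (\<kappa> y = k) * g y * \<Phi> (x \<bullet> q k)))"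
      using int1 int2 by simp
    also have "\<bar>\<dots>\<bar> \<le> (LINT y|?M. \<bar>\<Phi> (x \<bullet> y) * g y - (\<Sum>k<K. of_bool (\<kappa> y = k) * g y * \<Phi> (x \<bullet> q k))\<bar>)"
      by (rule integral_abs_bound)
    also have "\<dots> \<le> (LINT y|?M. \<eta>)"
    proof (rule integral_mono_AE)
      show "AE y in ?M. \<bar>\<Phi> (x \<bullet> y) * g y - (\<Sum>k<K. of_bool (\<kappa> y = k) * g y * \<Phi> (x \<bullet> q k))\<bar> \<le> \<eta>"
        using g(2) AE_space
      proof eventually_elim
        case (elim y)
        then have y: "y \<in> sphere 0 1" using sp by auto
        have "\<bar>\<Phi> (x \<bullet> y) - \<Phi> (x \<bullet> q (\<kappa> y))\<bar> \<le> \<bar>x \<bullet> y - x \<bullet> q (\<kappa> y)\<bar>"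
          using \<kappa>(1)[OF y] by (intro \<Phi> inner01 x y q)
        also have "\<dots> \<le> \<eta>"
          using Cauchy_Schwarz_ineq2[of x "y - q (\<kappa> y)"] x \<kappa>(2)[OF y]
          by (simp add: inner_diff_right dist_norm)
        finally have "\<bar>\<Phi> (x \<bullet> y) - \<Phi> (x \<bullet> q (\<kappa> y))\<bar> * \<bar>g y\<bar> \<le> \<eta> * 1"
          using elim(1) by (intro mult_mono) auto
        then show ?case
          unfolding sum_eq[OF elim(2)] by (simp add: left_diff_distrib[symmetric] abs_mult)
      qed
    qed (use int1 int2 in auto)
    also have "\<dots> = \<eta>" by (simp add: prob_space)
    finally show ?thesis .
  qed
  \<comment> \<open>A point assigned to \<open>k\<close> lies within \<open>\<eta>\<close> of
    \<open>q k\<close>, hence in \<open>A\<close> if \<open>k \<in> T\<close>; since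
    \<open>\<bar>g\<bar> \<le> 1\<close> almost everywhere, its density is at most the indicator of
    \<open>A\<close>.\<close>
  have mass: "(\<Sum>k\<in>T. a 1 k + a (-1) k) \<le> measure sphere_borel_measure A"
    if T: "T \<subseteq> {..<K}" and A: "A \<in> sets borel" "A \<subseteq> sphere 0 1"
      and near: "\<forall>y\<in>sphere 0 1. \<forall>k\<in>T. dist y (q k) \<le> \<eta> \<longrightarrow> y \<in> A" for T A
  proof -
    have finT: "finite T" using T finite_subset by blast
    have Ab: "A \<in> sets sphere_borel_measure"
      using A by (auto simp: sets_sphere_borel_measure sets_restrict_space_iff)
    then have AM [measurable]: "A \<in> sets ?M" by (simp add: sphere_measure_def)
    have "(\<Sum>k\<in>T. a 1 k + a (-1) k) = (LINT y|?M. (\<Sum>k\<in>T. of_bool (\<kappa> y = k) * \<bar>g y\<bar>))"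
      unfolding aplus by (subst Bochner_Integration.integral_sum) (auto intro!: int_absg)
    also have "\<dots> \<le> (LINT y|?M. indicator A y)"
    proof (rule integral_mono_AE)
      show "AE y in ?M. (\<Sum>k\<in>T. of_bool (\<kappa> y = k) * \<bar>g y\<bar>) \<le> indicator A y"
        using g(2) AE_space
      proof eventually_elim
        case (elim y)
        then have y: "y \<in> sphere 0 1" using sp by auto
        have "(\<Sum>k\<in>T. of_bool (\<kappa> y = k) * \<bar>g y\<bar>) = (\<Sum>k\<in>T. if k = \<kappa> y then \<bar>g y\<bar> else 0)"
          by (intro sum.cong) auto
        also have "\<dots> = (if \<kappa> y \<in> T then \<bar>g y\<bar> else 0)" using finT by (simp add: sum.delta)
        also have "\<dots> \<le> indicator A y"
          using elim(1) near y \<kappa>(2)[OF y] by (auto simp: indicator_def)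
        finally show ?case .
      qed
      show "integrable ?M (\<lambda>y. \<Sum>k\<in>T. of_bool (\<kappa> y = k) * \<bar>g y\<bar>)"
        by (intro Bochner_Integration.integrable_sum int_absg)
    qed (simp add: less_top[symmetric])
    also have "\<dots> = measure ?M A" by simp
    also have "\<dots> = measure sphere_borel_measure A"
      unfolding sphere_measure_def using Ab by (simp add: measure_completion)
    finally show ?thesis .
  qed
  show ?thesis using a0 approx mass by (intro exI[of _ a]) blast
qed

section \<open>Cells and the knots of the piecewise polynomial\<close>

text \<open>The segment from \<open>p\<close> to \<open>q\<close>, projected radially, is a path on
  the sphere to which the intermediate value theorem applies. \<open>dist p q < 2\<close> excludes
  antipodal points, whose segment meets the origin.\<close>

lemma sphere_level_point_between:
  fixes p q x :: "'a :: euclidean_space"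
  assumes pq: "p \<in> sphere 0 1" "q \<in> sphere 0 1" "dist p q < 2" and s: "x \<bullet> p \<le> s" "s \<le> x \<bullet> q"
  shows "\<exists>z\<in>sphere 0 1. x \<bullet> z = s \<and> dist z p \<le> 2 * dist p q"
proof -
  define m where "m t = p + t *\<^sub>R (q - p)" for t :: real
  have mp: "norm (m t - p) = t * dist p q" if "0 \<le> t" for t
    using that by (simp add: m_def dist_norm norm_minus_commute)
  have mq: "norm (m t - q) = (1 - t) * dist p q" if "t \<le> 1" for t
  proof -
    have "m t - q = (1 - t) *\<^sub>R (p - q)" by (simp add: m_def algebra_simps)
    then show ?thesis using that by (simp add: dist_norm)
  qed
  have m0: "norm (m t) > 0" if t: "0 \<le> t" "t \<le> 1" for t
  proof (rule ccontr)
    assume "\<not> norm (m t) > 0"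
    then have "m t = 0" by simp
    then have "1 = t * dist p q" "1 = (1 - t) * dist p q" using mp[OF t(1)] mq[OF t(2)] pq by simp_all
    then have "2 = dist p q" by (simp add: algebra_simps)
    then show False using pq by simp
  qed
  have "continuous_on {0..1} (\<lambda>t. x \<bullet> (m t /\<^sub>R norm (m t)))"
    using m0 unfolding m_def by (intro continuous_intros) force+
  moreover have "x \<bullet> (m 0 /\<^sub>R norm (m 0)) \<le> s" "s \<le> x \<bullet> (m 1 /\<^sub>R norm (m 1))"
    using s pq by (simp_all add: m_def)
  ultimately obtain t where t: "0 \<le> t" "t \<le> 1" "x \<bullet> (m t /\<^sub>R norm (m t)) = s"
    using IVT'[of "\<lambda>t. x \<bullet> (m t /\<^sub>R norm (m t))" 0 s 1] by auto
  define z where "z = m t /\<^sub>R norm (m t)"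
  have z: "norm z = 1" using m0[OF t(1,2)] by (simp add: z_def)
  \<comment> \<open>As \<open>p\<close> has norm 1, the projection moves \<open>m t\<close> by at
    most its distance from \<open>p\<close>; hence the factor 2.\<close>
  have "z - m t = (1 - norm (m t)) *\<^sub>R z" using m0[OF t(1,2)] by (simp add: z_def algebra_simps)
  then have "norm (z - m t) = \<bar>norm p - norm (m t)\<bar>" using z pq by simp
  also have "\<dots> \<le> norm (m t - p)" by (metis abs_minus_commute norm_triangle_ineq3)
  finally have "norm (z - m t) \<le> norm (m t - p)" .
  then have "norm (z - p) \<le> 2 * norm (m t - p)"
    using norm_triangle_ineq[of "z - m t" "m t - p"] by simp
  also have "\<dots> \<le> 2 * (1 * dist p q)"
    unfolding mp[OF t(1)] using t by (intro mult_left_mono mult_right_mono) auto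
  finally show ?thesis using t z by (intro bexI[of _ z]) (auto simp: dist_norm z_def)
qed

text \<open>If the inner products over \<open>G\<close> straddle an interior knot, a point on its
  level lies within \<open>2 * D\<close> of one point of \<open>G\<close>, hence within
  \<open>3 * D\<close> of all. Otherwise they all lie between two consecutive knots, since the end
  knots cannot separate inner products of unit vectors.\<close>

lemma polynomial_or_near_level:
  fixes x :: "'a :: euclidean_space" and s :: "nat \<Rightarrow> real"
  assumes s: "s 0 = -1" "s l = 1" "\<forall>i<l. s i < s (Suc i)"
    and \<Phi>: "piecewise_polynomial r l s \<Phi>"
    and x: "x \<in> sphere 0 1" and G: "G \<subseteq> sphere 0 1" "\<And>p q. p \<in> G \<Longrightarrow> q \<in> G \<Longrightarrow> dist p q \<le> D" and D: "D < 2"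
  shows "(\<exists>P. degree P \<le> r \<and> (\<forall>p\<in>G. \<Phi> (x \<bullet> p) = poly P (x \<bullet> p)))
    \<or> (\<exists>i\<in>{1..<l}. \<exists>z\<in>sphere 0 1. x \<bullet> z = s i \<and> (\<forall>p\<in>G. dist p z \<le> 3 * D))"
proof (cases "\<exists>i\<in>{1..<l}. \<exists>p\<in>G. \<exists>q\<in>G. x \<bullet> p \<le> s i \<and> s i \<le> x \<bullet> q")
  case True
  then obtain i p q where i: "i \<in> {1..<l}" and pq: "p \<in> G" "q \<in> G" "x \<bullet> p \<le> s i" "s i \<le> x \<bullet> q" by blast
  have "dist p q \<le> D" using G(2) pq by blast
  then obtain z where z: "z \<in> sphere 0 1" "x \<bullet> z = s i" "dist z p \<le> 2 * dist p q"
    using sphere_level_point_between[of p q x "s i"] pq G(1) D by (metis le_less_trans subsetD)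
  have "dist p' z \<le> 3 * D" if "p' \<in> G" for p'
    using dist_triangle[of p' z p] G(2)[OF that pq(1)] z(3) \<open>dist p q \<le> D\<close> by (simp add: dist_commute)
  then show ?thesis using i z by blast
next
  case False
  have inner01: "-1 \<le> x \<bullet> p" "x \<bullet> p \<le> 1" if "p \<in> G" for p
    using Cauchy_Schwarz_ineq2[of x p] x G(1) that by (auto simp: abs_le_iff)
  have "l \<ge> 1" using s by (cases l) auto
  \<comment> \<open>The first knot above all inner products. The knot before it is exceeded by some
    point of \<open>G\<close>, hence is below all of them, as no interior knot is straddled.\<close>
  define i where "i = (LEAST i. \<forall>p\<in>G. x \<bullet> p \<le> s i)"
  have l: "\<forall>p\<in>G. x \<bullet> p \<le> s l" using inner01 s by simp
  have i: "\<forall>p\<in>G. x \<bullet> p \<le> s i" "i \<le> l"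
    unfolding i_def using LeastI[of "\<lambda>i. \<forall>p\<in>G. x \<bullet> p \<le> s i", OF l]
      Least_le[of "\<lambda>i. \<forall>p\<in>G. x \<bullet> p \<le> s i", OF l] by auto
  have "\<exists>j\<in>{1..l}. \<forall>p\<in>G. x \<bullet> p \<in> {s (j - 1)..s j}"
  proof (cases i)
    case 0
    have "s 0 < s 1" using s(3)[rule_format, of 0] \<open>l \<ge> 1\<close> by simp
    then have "x \<bullet> p \<in> {s (1 - 1)..s 1}" if "p \<in> G" for p
      using i(1) 0 inner01[OF that] that s(1) by force
    then show ?thesis using \<open>l \<ge> 1\<close> by (intro bexI[of _ 1]) auto
  next
    case (Suc j)
    have "\<not> (\<forall>p\<in>G. x \<bullet> p \<le> s j)"
      using not_less_Least[of j "\<lambda>i. \<forall>p\<in>G. x \<bullet> p \<le> s i"] Suc by (simp add: i_def)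
    then obtain q where q: "q \<in> G" "s j < x \<bullet> q" by (auto simp: not_le)
    have "s j \<le> x \<bullet> p" if p: "p \<in> G" for p
    proof (cases "j = 0")
      case True
      then show ?thesis using inner01[OF p] s by simp
    next
      case jn: False
      then have "j \<in> {1..<l}" using Suc i(2) by auto
      then have "\<not> x \<bullet> p \<le> s j" using False p q less_imp_le by blast
      then show ?thesis by simp
    qed
    then show ?thesis using i Suc by (intro bexI[of _ i]) auto
  qed
  then obtain j where j: "j \<in> {1..l}" "\<forall>p\<in>G. x \<bullet> p \<in> {s (j - 1)..s j}" by blast
  then obtain P where "degree P \<le> r" "\<forall>t\<in>{s (j - 1)..s j}. \<Phi> t = poly P t"
    using \<Phi> unfolding piecewise_polynomial_def by blast
  then show ?thesis using j by blast
qed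

section \<open>The coarse net, the constants and the enumeration of the points\<close>

text \<open>The constant is 32 = 4 * 8: the packing count becomes
  \<open>2 * (d + 1) * N / 8 ^ d\<close>, and \<open>4 * (d + 1) \<le> 8 ^ d\<close> brings it below
  \<open>N/2\<close>. If the radius exceeds 2, the diameter of the sphere, a single point is a
  net.\<close>

lemma coarse_sphere_net:
  assumes d: "CARD('n) = d + 1" "d \<ge> 1" and N: "N \<ge> 2"
  obtains C :: "(real ^ 'n) set" where "finite C" "real (card C) \<le> real N / 2"
    "\<And>y. y \<in> sphere 0 1 \<Longrightarrow> \<exists>c\<in>C. dist y c \<le> 32 * real N powr (- 1 / real d)"
proof (cases "32 * real N powr (- 1 / real d) \<le> 2")
  case True
  define \<rho> where "\<rho> = 32 * real N powr (- 1 / real d)"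
  have \<rho>: "0 < \<rho>" "\<rho> \<le> 2" using True N by (simp_all add: \<rho>_def)
  have "DIM(real ^ 'n) = d + 1" using d by simp
  then obtain C :: "(real ^ 'n) set" where C: "finite C" "real (card C) \<le> 2 * (real d + 1) * (4 / \<rho>) ^ d"
    "\<And>y. y \<in> sphere 0 1 \<Longrightarrow> \<exists>c\<in>C. dist y c \<le> \<rho>"
    using sphere_net_exists[of d \<rho>] \<rho> by metis
  have "4 / \<rho> = real N powr (1 / real d) / 8" by (simp add: \<rho>_def powr_minus field_simps)
  then have "(4 / \<rho>) ^ d = (real N powr (1 / real d)) ^ d / 8 ^ d" by (simp only: power_divide)
  also have "(real N powr (1 / real d)) ^ d = real N"
    using d N by (simp add: powr_realpow[symmetric] powr_powr)
  finally have e: "(4 / \<rho>) ^ d = real N / 8 ^ d" .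
  have "4 * (real d + 1) \<le> 8 ^ d"
    using d(2) by (induction d rule: nat_induct_at_least) auto
  then have "4 * (real d + 1) * real N \<le> 8 ^ d * real N" by (intro mult_right_mono) auto
  then have "2 * (real d + 1) * (4 / \<rho>) ^ d \<le> real N / 2" unfolding e by (simp add: field_simps)
  with C(2) have "real (card C) \<le> real N / 2" by linarith
  then show thesis using that[OF C(1)] C(3) unfolding \<rho>_def by blast
next
  case False
  obtain b :: "real ^ 'n" where b: "b \<in> Basis" using nonempty_Basis by blast
  have "dist y b \<le> 32 * real N powr (- 1 / real d)" if "y \<in> sphere 0 1" for y
  proof -
    have "dist y b \<le> norm y + norm b" unfolding dist_norm by (rule norm_triangle_ineq4)
    then show ?thesis using that b False by simp
  qed
  then show thesis using that[of "{b}"] N by auto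
qed

text \<open>All terms are compared with \<open>R\<close>, the target without its constant. The
  square of the product of roots is \<open>469762048 * R\<^sup>2\<close>: 8 comes from the variance,
  4 from the squared diameter, 16 * 7 from the neighbourhoods of the levels, 32 ^ 3 from
  \<open>\<rho> ^ 3\<close> and 4 from the logarithm. 50000 is a generous bound for the
  root.\<close>

lemma error_budget:
  fixes d l N :: nat
  assumes d: "d \<ge> 1" and l: "l \<ge> 1" and N: "N \<ge> 20"
  defines "\<rho> \<equiv> 32 * real N powr (- 1 / real d)"
  shows "3 * (1 / (real N)\<^sup>2)
      + 2 * sqrt (8 * (2 * \<rho>)\<^sup>2 * (16 * (7 * \<rho>) * sqrt (real d) * real l) / real N) * sqrt (4 * real d * ln (real N))
    \<le> 7 * 10 ^ 6 * sqrt (real l) * real d powr (3 / 4)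
        * real N powr (- 1 / 2 - 3 / (2 * real d)) * sqrt (ln (real N))"
proof -
  define R where "R = sqrt (real l) * real d powr (3 / 4) * real N powr (- 1 / 2 - 3 / (2 * real d)) * sqrt (ln (real N))"
  have "exp 1 \<le> real N" using exp_le N by linarith
  then have lnN: "1 \<le> ln (real N)" using N by (subst ln_ge_iff) auto
  have R0: "0 \<le> R" using lnN by (simp add: R_def)
  have "real N powr (- 2) \<le> real N powr (- 1 / 2 - 3 / (2 * real d))"
    using N d by (intro powr_mono) (auto simp: field_simps)
  also have "real N powr (- 2) = 1 / (real N)\<^sup>2"
    using N by (simp add: powr_minus powr_numeral inverse_eq_divide)
  also have "real N powr (- 1 / 2 - 3 / (2 * real d)) \<le> R"
  proof -
    have "1 * 1 \<le> sqrt (real l) * real d powr (3 / 4)"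
      using l d by (intro mult_mono) (auto simp: ge_one_powr_ge_zero)
    then have "1 * real N powr (- 1 / 2 - 3 / (2 * real d)) * 1
        \<le> sqrt (real l) * real d powr (3 / 4) * real N powr (- 1 / 2 - 3 / (2 * real d)) * sqrt (ln (real N))"
      using lnN by (intro mult_mono) auto
    then show ?thesis by (simp add: R_def)
  qed
  finally have small: "1 / (real N)\<^sup>2 \<le> R" .
  have d32: "(real d powr (3 / 4))\<^sup>2 = real d * sqrt (real d)"
  proof -
    have "(real d powr (3 / 4))\<^sup>2 = real d powr (1 + 1 / 2)"
      using d by (simp add: power2_eq_square powr_add[symmetric])
    also have "\<dots> = real d * sqrt (real d)" unfolding powr_add using d by (simp add: powr_half_sqrt)
    finally show ?thesis .
  qed
  have N2: "(real N powr (- 1 / 2 - 3 / (2 * real d)))\<^sup>2 = (real N powr (- 1 / real d)) ^ 3 / real N"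
  proof -
    have "(- 1 / 2 - 3 / (2 * real d)) + (- 1 / 2 - 3 / (2 * real d)) = - 3 / real d - 1" by simp
    then have "(real N powr (- 1 / 2 - 3 / (2 * real d)))\<^sup>2 = real N powr (- 3 / real d - 1)"
      unfolding power2_eq_square powr_add[symmetric] by (rule arg_cong)
    also have "\<dots> = real N powr (- 3 / real d) / real N" using N by (simp add: powr_diff)
    also have "real N powr (- 3 / real d) = (real N powr (- 1 / real d)) ^ 3"
      using N by (simp add: powr_realpow[symmetric] powr_powr)
    finally show ?thesis .
  qed
  have R2: "R\<^sup>2 = real l * (real d * sqrt (real d)) * ((real N powr (- 1 / real d)) ^ 3 / real N) * ln (real N)"
    unfolding R_def power_mult_distrib d32 N2 using lnN by simp
  have "8 * (2 * \<rho>)\<^sup>2 * (16 * (7 * \<rho>) * sqrt (real d) * real l) / real N * (4 * real d * ln (real N))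
      = 469762048 * R\<^sup>2"
    unfolding R2 \<rho>_def by (simp add: power2_eq_square power3_eq_cube mult_ac)
  also have "\<dots> \<le> (50000 * R)\<^sup>2" by (simp add: power_mult_distrib)
  finally have "sqrt (8 * (2 * \<rho>)\<^sup>2 * (16 * (7 * \<rho>) * sqrt (real d) * real l) / real N) * sqrt (4 * real d * ln (real N))
      \<le> 50000 * R"
    unfolding real_sqrt_mult[symmetric] using R0 by (intro real_le_lsqrt) auto
  then have "3 * (1 / (real N)\<^sup>2)
      + 2 * sqrt (8 * (2 * \<rho>)\<^sup>2 * (16 * (7 * \<rho>) * sqrt (real d) * real l) / real N) * sqrt (4 * real d * ln (real N))
      \<le> 3 * R + 2 * (50000 * R)"
    using small by linarith
  also have "\<dots> \<le> 7 * 10 ^ 6 * R" using R0 by simp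
  finally show ?thesis by (simp add: R_def mult.assoc)
qed

text \<open>Passes from a sparse weight on the net to a list of prescribed length: surplus positions
  repeat \<open>q 0\<close> with weight zero, and \<open>0 < K\<close> makes \<open>q 0\<close> a
  net point.\<close>

lemma padded_enumeration:
  fixes v :: "nat \<Rightarrow> real" and q :: "nat \<Rightarrow> 'a"
  assumes "card {k. k < K \<and> v k \<noteq> 0} \<le> n" and "0 < K"
  shows "\<exists>\<xi> w. (\<forall>j. \<xi> j \<in> q ` {..<K}) \<and> (\<forall>f. (\<Sum>j = 1..n. w j * f (\<xi> j)) = (\<Sum>k<K. v k * (f (q k) :: real)))"
proof -
  define S where "S = {k. k < K \<and> v k \<noteq> 0}"
  have finS: "finite S" by (simp add: S_def)
  obtain h where h: "bij_betw h {1..card S} S" using ex_bij_betw_nat_finite_1[OF finS] by blast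
  define \<xi> where "\<xi> j = (if j \<in> {1..card S} then q (h j) else q 0)" for j
  define w where "w j = (if j \<in> {1..card S} then v (h j) else 0)" for j
  have "\<xi> j \<in> q ` {..<K}" for j
    using bij_betwE[OF h] \<open>0 < K\<close> unfolding \<xi>_def S_def by auto
  moreover have "(\<Sum>j = 1..n. w j * f (\<xi> j)) = (\<Sum>k<K. v k * f (q k))" for f
  proof -
    have "(\<Sum>j = 1..n. w j * f (\<xi> j)) = (\<Sum>j = 1..card S. v (h j) * f (q (h j)))"
      using assms(1) by (intro sum.mono_neutral_cong_right) (auto simp: w_def \<xi>_def S_def[symmetric])
    also have "\<dots> = (\<Sum>k\<in>S. v k * f (q k))" by (rule sum.reindex_bij_betw[OF h])
    also have "\<dots> = (\<Sum>k<K. v k * f (q k))"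
      by (intro sum.mono_neutral_cong_left) (auto simp: S_def)
    finally show ?thesis .
  qed
  ultimately show ?thesis by blast
qed

theorem theorem7p2:
  fixes d r l N :: nat
    and \<Phi> :: "real \<Rightarrow> real"
    and s :: "nat \<Rightarrow> real"
    and g :: "real ^ 'n \<Rightarrow> real"
  assumes "d \<ge> 1"
    and "CARD('n) = d + 1"
    and "s 0 = -1" and "s l = 1" and "\<forall>i<l. s i < s (Suc i)"
    and "piecewise_polynomial r l s \<Phi>"
    and "\<forall>t\<in>{-1..1}. \<forall>t'\<in>{-1..1}. \<bar>\<Phi> t - \<Phi> t'\<bar> \<le> \<bar>t - t'\<bar>"
    and "g \<in> borel_measurable sphere_measure"
    and "esssup sphere_measure (\<lambda>y. ereal \<bar>g y\<bar>) \<le> 1"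
    and "N \<ge> 20"
  shows "\<exists>(\<xi> :: nat \<Rightarrow> real ^ 'n) (w :: nat \<Rightarrow> real).
    (\<forall>j\<in>{1..2 * (dim_spherical_polynomials TYPE('n) r + 2) * N}. \<xi> j \<in> sphere 0 1) \<and>
    (\<forall>x\<in>sphere 0 1.
      \<bar>(LINT y|sphere_measure. \<Phi> (x \<bullet> y) * g y)
        - (\<Sum>j = 1..2 * (dim_spherical_polynomials TYPE('n) r + 2) * N. w j * \<Phi> (x \<bullet> \<xi> j))\<bar>
      \<le> 7 * 10 ^ 6 * sqrt (real l) * real d powr (3 / 4)
          * real N powr (- 1 / 2 - 3 / (2 * real d)) * sqrt (ln (real N)))"
proof -
  define m where "m = dim_spherical_polynomials TYPE('n) r"
  have l1: "l \<ge> 1" using assms(3,4) by (cases l) auto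
  have N0: "real N > 0" using assms(10) by simp
  have lip: "\<bar>\<Phi> t - \<Phi> t'\<bar> \<le> \<bar>t - t'\<bar>" if "t \<in> {-1..1}" "t' \<in> {-1..1}" for t t'
    using assms(7) that by blast
  have inner01: "x \<bullet> y \<in> {-1..1}" if "x \<in> sphere 0 1" "y \<in> sphere 0 1" for x y :: "real ^ 'n"
    using Cauchy_Schwarz_ineq2[of x y] that by (auto simp: abs_le_iff)
  have \<Phi>diff: "\<bar>\<Phi> (x \<bullet> y) - \<Phi> (x \<bullet> z)\<bar> \<le> dist y z"
    if "x \<in> sphere 0 1" "y \<in> sphere 0 1" "z \<in> sphere 0 1" for x y z :: "real ^ 'n"
  proof -
    have "\<bar>\<Phi> (x \<bullet> y) - \<Phi> (x \<bullet> z)\<bar> \<le> \<bar>x \<bullet> y - x \<bullet> z\<bar>" by (intro lip inner01 that)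
    also have "\<dots> \<le> dist y z"
      using Cauchy_Schwarz_ineq2[of x "y - z"] that by (simp add: inner_diff_right dist_norm)
    finally show ?thesis .
  qed
  have g1: "AE y in sphere_measure. \<bar>g y\<bar> \<le> 1"
    using esssup_AE[of "\<lambda>y. ereal \<bar>g y\<bar>" sphere_measure]
  proof eventually_elim
    case (elim y)
    then have "ereal \<bar>g y\<bar> \<le> 1" using assms(9) by (rule order_trans)
    then show ?case by (simp add: one_ereal_def)
  qed
  define \<rho> where "\<rho> = 32 * real N powr (- 1 / real d)"
  \<comment> \<open>Fine enough for the final bound, whose power of \<open>N\<close> is smallest for
    \<open>d = 1\<close>, namely -2, and coarse enough for the logarithm of the size of the net to
    be O(\<open>d * ln N\<close>).\<close>
  define \<eta> where "\<eta> = 1 / (real N)\<^sup>2"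
  have \<rho>0: "\<rho> > 0" using N0 by (simp add: \<rho>_def)
  have \<eta>0: "\<eta> > 0" "\<eta> \<le> 1" using assms(10) by (auto simp: \<eta>_def field_simps)
  have \<eta>\<rho>: "\<eta> \<le> \<rho>"
  proof -
    have "\<eta> = real N powr (- 2)"
      using N0 by (simp add: \<eta>_def powr_minus powr_numeral inverse_eq_divide)
    also have "\<dots> \<le> real N powr (- 1 / real d)"
      using assms(1,10) by (intro powr_mono) (auto simp: field_simps)
    finally show ?thesis using powr_ge_zero[of "real N" "- 1 / real d"] unfolding \<rho>_def by linarith
  qed
  obtain C :: "(real ^ 'n) set" where C: "finite C" "real (card C) \<le> real N / 2"
    "\<And>y. y \<in> sphere 0 1 \<Longrightarrow> \<exists>c\<in>C. dist y c \<le> \<rho>"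
    using coarse_sphere_net[OF assms(2,1), of N] assms(10) unfolding \<rho>_def by auto
  have DIM: "DIM(real ^ 'n) = d + 1" using assms(2) by simp
  obtain P :: "(real ^ 'n) set" where P: "finite P" "P \<noteq> {}" "P \<subseteq> sphere 0 1"
    "real (card P) \<le> 2 * (real d + 1) * (4 / \<eta>) ^ d" "\<And>y. y \<in> sphere 0 1 \<Longrightarrow> \<exists>p\<in>P. dist y p \<le> \<eta>"
    using sphere_net_exists[OF DIM \<eta>0(1)] \<eta>0(2) by auto
  define K where "K = card P"
  have K0: "K > 0" using P by (simp add: K_def card_gt_0_iff)
  obtain q where "bij_betw q {0..<K} P" unfolding K_def using ex_bij_betw_nat_finite[OF P(1)] by blast
  then have qP: "q ` {..<K} = P" by (simp add: bij_betw_def atLeast0LessThan)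
  then have q: "q k \<in> sphere 0 1" if "k < K" for k using P(3) that by blast
  have cover: "\<exists>k<K. dist y (q k) \<le> \<eta>" if "y \<in> sphere 0 1" for y
    using P(5)[OF that] qP by (metis imageE lessThan_iff)
  have "\<forall>k\<in>{..<K}. \<exists>c\<in>C. dist (q k) c \<le> \<rho>" using C(3) q by auto
  then obtain \<gamma> where \<gamma>: "\<And>k. k < K \<Longrightarrow> \<gamma> k \<in> C" "\<And>k. k < K \<Longrightarrow> dist (q k) (\<gamma> k) \<le> \<rho>"
    by (metis lessThan_iff)
  have \<gamma>dist: "dist (q k) (q k') \<le> 2 * \<rho>" if "k < K" "k' < K" "\<gamma> k = \<gamma> k'" for k k'
    using dist_triangle2[of "q k" "q k'" "\<gamma> k"] \<gamma>(2)[OF that(1)] \<gamma>(2)[OF that(2)] that(3) by simp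
  have "\<exists>a :: real \<Rightarrow> nat \<Rightarrow> real. (\<forall>e k. 0 \<le> a e k) \<and>
    (\<forall>x\<in>sphere 0 1. \<bar>(LINT y|sphere_measure. \<Phi> (x \<bullet> y) * g y) - (\<Sum>k<K. (a 1 k - a (-1) k) * \<Phi> (x \<bullet> q k))\<bar> \<le> \<eta>) \<and>
    (\<forall>T A. T \<subseteq> {..<K} \<longrightarrow> A \<in> sets borel \<longrightarrow> A \<subseteq> sphere 0 1 \<longrightarrow>
      (\<forall>y\<in>sphere 0 1. \<forall>k\<in>T. dist y (q k) \<le> \<eta> \<longrightarrow> y \<in> A) \<longrightarrow>
      (\<Sum>k\<in>T. a 1 k + a (-1) k) \<le> measure sphere_borel_measure A)"
    by (rule discretize_density[OF assms(8) g1]) (erule cover, erule q, erule (1) lip)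
  then obtain a :: "real \<Rightarrow> nat \<Rightarrow> real" where a_props: "\<forall>e k. 0 \<le> a e k"
    "\<forall>x\<in>sphere 0 1. \<bar>(LINT y|sphere_measure. \<Phi> (x \<bullet> y) * g y) - (\<Sum>k<K. (a 1 k - a (-1) k) * \<Phi> (x \<bullet> q k))\<bar> \<le> \<eta>"
    "\<forall>T A. T \<subseteq> {..<K} \<longrightarrow> A \<in> sets borel \<longrightarrow> A \<subseteq> sphere 0 1 \<longrightarrow>
      (\<forall>y\<in>sphere 0 1. \<forall>k\<in>T. dist y (q k) \<le> \<eta> \<longrightarrow> y \<in> A) \<longrightarrow>
      (\<Sum>k\<in>T. a 1 k + a (-1) k) \<le> measure sphere_borel_measure A"
    by (elim exE conjE) (rule that)
  have a0: "0 \<le> a e k" for e k using a_props(1) by blast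
  note approx = a_props(2)[rule_format] and mass = a_props(3)[rule_format]
  interpret prob_space "sphere_borel_measure :: (real ^ 'n) measure" by (rule prob_space_sphere_borel_measure)
  have total: "measure sphere_borel_measure (sphere (0 :: real ^ 'n) 1) = 1"
    using prob_space by (simp add: space_sphere_borel_measure)
  have mass1: "(\<Sum>k<K. a 1 k + a (-1) k) \<le> 1"
    using mass[of "{..<K}" "sphere 0 1"] total by simp
  obtain B :: "(real ^ 'n \<Rightarrow> real) set" where B: "finite B" "card B = m" "spherical_polynomials r \<subseteq> fun_space.span B"
    unfolding m_def by (rule spherical_polynomials_basis)
  \<comment> \<open>The moments as functions of the net index. Different basis elements may agree on
    the net, so the cardinality is only bounded by \<open>m\<close>.\<close>
  define B' where "B' = (\<lambda>b k. b (q k)) ` B"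
  have B': "finite B'" "card B' \<le> m" using B by (auto simp: B'_def card_image_le)
  have exact_poly: "(\<Sum>k<K. u k * poly p (x \<bullet> q k)) = 0"
    if u: "\<forall>b\<in>B'. (\<Sum>k<K. u k * b k) = 0" and p: "degree p \<le> r" for u p x
  proof -
    define f where "f = (\<lambda>y :: real ^ 'n. if y \<in> sphere 0 1 then poly p (x \<bullet> y) else 0)"
    have "f \<in> fun_space.span B"
      unfolding f_def by (rule subsetD[OF B(3) poly_inner_in_spherical_polynomials[OF p]])
    then have "(\<Sum>k<K. u k * f (q k)) = (\<Sum>k<K. 0 * f (q k))"
    proof (rule equal_moments_span)
      fix b assume "b \<in> B"
      then have "(\<lambda>k. b (q k)) \<in> B'" unfolding B'_def by (rule imageI)
      from bspec[OF u this] show "(\<Sum>k<K. u k * b (q k)) = (\<Sum>k<K. 0 * b (q k))" by simp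
    qed
    then show ?thesis using q by (simp add: f_def)
  qed
  have one: "(\<Sum>k<K. u k) = 0" if "\<forall>b\<in>B'. (\<Sum>k<K. u k * b k) = 0" for u
    using exact_poly[OF that, of "[:1:]"] by simp
  define \<Psi> where "\<Psi> x k = \<Phi> (q x \<bullet> q k)" for x k
  define E where "E x c \<longleftrightarrow> (\<exists>p. degree p \<le> r \<and> (\<forall>k<K. \<gamma> k = c \<longrightarrow> \<Psi> x k = poly p (q x \<bullet> q k)))" for x c
  \<comment> \<open>7 = 3 * 2 + 1: cells have diameter at most \<open>2 * \<rho>\<close>, a cell
    without a common polynomial lies within \<open>3 * (2 * \<rho>)\<close> of a point on a level,
    and passing from net points to the points they represent costs
    \<open>\<eta> \<le> \<rho>\<close>.\<close>
  define \<kappa> where "\<kappa> = 16 * (7 * \<rho>) * sqrt (real d) * real l"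
  have \<kappa>0: "\<kappa> > 0" using \<rho>0 assms(1) l1 by (simp add: \<kappa>_def)
  have exact: "(\<Sum>k<K. u k * \<Psi> x k) = 0" if "x < K" "E x c" and supp: "\<forall>k<K. \<gamma> k \<noteq> c \<longrightarrow> u k = 0"
    and mom: "\<forall>b\<in>B'. (\<Sum>k<K. u k * b k) = 0" for x c u
  proof -
    obtain p where p: "degree p \<le> r" "\<forall>k<K. \<gamma> k = c \<longrightarrow> \<Psi> x k = poly p (q x \<bullet> q k)"
      using \<open>E x c\<close> unfolding E_def by blast
    have "(\<Sum>k<K. u k * \<Psi> x k) = (\<Sum>k<K. u k * poly p (q x \<bullet> q k))"
      using p(2) supp by (intro sum.cong) auto
    then show ?thesis using exact_poly[OF mom p(1)] by simp
  qed
  \<comment> \<open>For \<open>\<rho> \<ge> 1\<close> the bound \<open>\<kappa>\<close> exceeds the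
    total mass. Otherwise the diameter bound \<open>2 * \<rho>\<close> is below 2, as the search for
    a point on a level requires.\<close>
  have crossing: "(\<Sum>k | k < K \<and> \<not> E x (\<gamma> k). a 1 k + a (-1) k) \<le> \<kappa>" if x: "x < K" for x
  proof (cases "\<rho> \<ge> 1")
    case True
    have "1 * 1 * 1 \<le> 16 * (7 * \<rho>) * sqrt (real d) * real l"
      using True assms(1) l1 by (intro mult_mono) auto
    then have "1 \<le> \<kappa>" by (simp add: \<kappa>_def)
    moreover have "(\<Sum>k | k < K \<and> \<not> E x (\<gamma> k). a 1 k + a (-1) k) \<le> measure sphere_borel_measure (sphere (0 :: real ^ 'n) 1)"
      by (intro mass) auto
    ultimately show ?thesis using total by simp
  next
    case False
    have "\<forall>i. \<exists>A\<in>sets borel. A \<subseteq> sphere 0 1 \<and> measure sphere_borel_measure A \<le> 16 * (7 * \<rho>) * sqrt (real d)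
      \<and> (\<forall>y\<in>sphere 0 1. \<forall>z\<in>sphere 0 1. q x \<bullet> z = s i \<longrightarrow> dist y z \<le> 7 * \<rho> \<longrightarrow> y \<in> A)"
      using sphere_level_neighbourhood[OF assms(2,1), of "q x" "7 * \<rho>"] q[OF x] \<rho>0 by simp
    then obtain A where A: "\<And>i. A i \<in> sets borel" "\<And>i. A i \<subseteq> sphere 0 1"
      "\<And>i. measure sphere_borel_measure (A i) \<le> 16 * (7 * \<rho>) * sqrt (real d)"
      "\<And>i y z. y \<in> sphere 0 1 \<Longrightarrow> z \<in> sphere 0 1 \<Longrightarrow> q x \<bullet> z = s i \<Longrightarrow> dist y z \<le> 7 * \<rho> \<Longrightarrow> y \<in> A i"
      by metis
    have As: "A i \<in> sets sphere_borel_measure" for i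
      using A(1,2) by (auto simp: sets_sphere_borel_measure sets_restrict_space_iff)
    have "(\<Sum>k | k < K \<and> \<not> E x (\<gamma> k). a 1 k + a (-1) k) \<le> measure sphere_borel_measure (\<Union>i\<in>{1..<l}. A i)"
    proof (rule mass)
      fix y k assume y: "y \<in> sphere 0 1" and k: "k \<in> {k. k < K \<and> \<not> E x (\<gamma> k)}" and yk: "dist y (q k) \<le> \<eta>"
      show "y \<in> (\<Union>i\<in>{1..<l}. A i)"
      proof -
        define G where "G = q ` {k'. k' < K \<and> \<gamma> k' = \<gamma> k}"
        have "(\<exists>p. degree p \<le> r \<and> (\<forall>y\<in>G. \<Phi> (q x \<bullet> y) = poly p (q x \<bullet> y)))
          \<or> (\<exists>i\<in>{1..<l}. \<exists>z\<in>sphere 0 1. q x \<bullet> z = s i \<and> (\<forall>y\<in>G. dist y z \<le> 3 * (2 * \<rho>)))"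
        proof (rule polynomial_or_near_level[OF assms(3-6) q[OF x]])
          show "G \<subseteq> sphere 0 1" using q by (auto simp: G_def simp del: mem_sphere mem_sphere_0)
          show "dist y z \<le> 2 * \<rho>" if "y \<in> G" "z \<in> G" for y z using that \<gamma>dist by (auto simp: G_def)
        qed (use False in simp)
        moreover have "\<not> (\<exists>p. degree p \<le> r \<and> (\<forall>y\<in>G. \<Phi> (q x \<bullet> y) = poly p (q x \<bullet> y)))"
          using k unfolding E_def G_def \<Psi>_def by blast
        ultimately obtain i z where iz: "i \<in> {1..<l}" "z \<in> sphere 0 1" "q x \<bullet> z = s i" "\<forall>y\<in>G. dist y z \<le> 3 * (2 * \<rho>)"
          by blast
        have "dist (q k) z \<le> 6 * \<rho>" using iz(4) k by (auto simp: G_def)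
        then have "dist y z \<le> 7 * \<rho>" using dist_triangle[of y z "q k"] yk \<eta>\<rho> by linarith
        then show ?thesis using A(4)[OF y iz(2,3)] iz(1) by blast
      qed
    qed (use A(1,2) in auto)
    also have "\<dots> \<le> (\<Sum>i\<in>{1..<l}. measure sphere_borel_measure (A i))"
      by (intro finite_measure_subadditive_finite) (use As in auto)
    also have "\<dots> \<le> (\<Sum>i\<in>{1..<l}. 16 * (7 * \<rho>) * sqrt (real d))" by (intro sum_mono A(3))
    also have "\<dots> = 16 * (7 * \<rho>) * sqrt (real d) * real (l - 1)" by simp
    also have "\<dots> \<le> \<kappa>" unfolding \<kappa>_def using \<rho>0 by (intro mult_left_mono) auto
    finally show ?thesis .
  qed
  define \<sigma> where "\<sigma> = sqrt (8 * (2 * \<rho>)\<^sup>2 * \<kappa> / real N)"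
  have \<sigma>: "0 < \<sigma>" "8 * (2 * \<rho>)\<^sup>2 * \<kappa> / real N \<le> \<sigma>\<^sup>2" using \<rho>0 \<kappa>0 N0 by (auto simp: \<sigma>_def)
  \<comment> \<open>The factor 4 records \<open>2 * K \<le> N ^ (4 * d)\<close>:
    \<open>4 * (d + 1) \<le> 8 ^ d\<close> absorbs the dimension, and
    \<open>32 \<le> N\<^sup>2\<close> the remaining base 8 * 4.\<close>
  define \<Lambda> where "\<Lambda> = 4 * real d * ln (real N)"
  have \<Lambda>0: "0 < \<Lambda>" using assms(1,10) by (simp add: \<Lambda>_def)
  have \<Lambda>: "ln (real (2 * K)) \<le> \<Lambda>"
  proof -
    have e: "4 * (real d + 1) \<le> 8 ^ d"
      using assms(1) by (induction d rule: nat_induct_at_least) auto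
    have "real (2 * K) \<le> 2 * (2 * (real d + 1) * (4 / \<eta>) ^ d)" using P(4) by (simp add: K_def)
    also have "\<dots> = 4 * (real d + 1) * (4 / \<eta>) ^ d" by simp
    also have "\<dots> \<le> 8 ^ d * (4 / \<eta>) ^ d" using e \<eta>0 by (intro mult_right_mono) auto
    also have "\<dots> = (8 * (4 / \<eta>)) ^ d" by (simp only: power_mult_distrib)
    also have "8 * (4 / \<eta>) = 32 * (real N)\<^sup>2" by (simp add: \<eta>_def)
    also have "(32 * (real N)\<^sup>2) ^ d \<le> ((real N) ^ 4) ^ d"
    proof (rule power_mono)
      have "(20 :: real)\<^sup>2 \<le> (real N)\<^sup>2" using assms(10) by (intro power_mono) auto
      then have "32 * (real N)\<^sup>2 \<le> (real N)\<^sup>2 * (real N)\<^sup>2" by (intro mult_right_mono) auto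
      then show "32 * (real N)\<^sup>2 \<le> real N ^ 4" by (simp add: power2_eq_square power4_eq_xxxx mult_ac)
    qed auto
    finally have "real (2 * K) \<le> real N ^ (4 * d)" by (simp add: power_mult)
    then have "ln (real (2 * K)) \<le> ln (real N ^ (4 * d))" using K0 N0 by (subst ln_le_cancel_iff) auto
    then show ?thesis using N0 by (simp add: ln_realpow \<Lambda>_def)
  qed
  have "\<exists>v. card {k. k < K \<and> v k \<noteq> 0} \<le> 2 * N * card B' \<and> (\<Sum>k<K. \<bar>v k\<bar>) \<le> 1 \<and>
    (\<forall>x<K. \<bar>(\<Sum>k<K. (a 1 k - a (-1) k) * \<Psi> x k) - (\<Sum>k<K. v k * \<Psi> x k)\<bar> \<le> 2 * \<sigma> * sqrt \<Lambda>)"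
  proof (rule sparse_signed_weights[where C = C and \<gamma> = \<gamma> and \<delta> = "2 * \<rho>" and \<kappa> = \<kappa> and E = E])
    fix x k k' assume "x < K" "k < K" "k' < K" "\<gamma> k = \<gamma> k'"
    then show "\<bar>\<Psi> x k - \<Psi> x k'\<bar> \<le> 2 * \<rho>"
      using \<Phi>diff[OF q q q, of x k k'] \<gamma>dist[of k k'] unfolding \<Psi>_def by linarith
  next
    fix x c u
    assume "x < K" "E x c" "\<forall>k<K. \<gamma> k \<noteq> c \<longrightarrow> u k = 0" "\<forall>b\<in>B'. (\<Sum>k<K. u k * b k) = 0"
    then show "(\<Sum>k<K. u k * \<Psi> x k) = 0" by (rule exact)
  next
    show "(\<Sum>k<K. u k) = 0" if "\<forall>b\<in>B'. (\<Sum>k<K. u k * b k) = 0" for u by (rule one[OF that])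
    show "(\<Sum>k | k < K \<and> \<not> E x (\<gamma> k). a 1 k + a (-1) k) \<le> \<kappa>" if "x < K" for x by (rule crossing[OF that])
    show "\<gamma> ` {..<K} \<subseteq> C" using \<gamma>(1) by auto
    show "0 < N" using assms(10) by simp
  qed (use B' C(1,2) a0 mass1 \<rho>0 \<sigma> \<Lambda>0 \<Lambda> in auto)
  then obtain v where v: "card {k. k < K \<and> v k \<noteq> 0} \<le> 2 * N * card B'" "(\<Sum>k<K. \<bar>v k\<bar>) \<le> 1"
    "\<And>x. x < K \<Longrightarrow> \<bar>(\<Sum>k<K. (a 1 k - a (-1) k) * \<Psi> x k) - (\<Sum>k<K. v k * \<Psi> x k)\<bar> \<le> 2 * \<sigma> * sqrt \<Lambda>"
    by blast
  \<comment> \<open>At most \<open>2 * N * m\<close> points carry weight; the remaining positions up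
    to \<open>n\<close> are filled by padding.\<close>
  define n where "n = 2 * (m + 2) * N"
  have "2 * N * card B' \<le> 2 * N * (m + 2)" using B'(2) by (intro mult_left_mono) auto
  then have "card {k. k < K \<and> v k \<noteq> 0} \<le> n" using v(1) by (simp add: n_def mult_ac)
  from padded_enumeration[OF this K0, of q] obtain \<xi> w where
    \<xi>: "\<And>j. \<xi> j \<in> q ` {..<K}" and w: "\<And>f. (\<Sum>j = 1..n. w j * f (\<xi> j)) = (\<Sum>k<K. v k * (f (q k) :: real))"
    by blast
  \<comment> \<open>One \<open>\<eta>\<close> is the price of discretizing the density. Two more pay
    for moving \<open>x\<close> to a net point, because the kernel is 1-Lipschitz in
    \<open>x\<close> and both discrete measures have total variation at most 1.\<close>
  have error: "\<bar>(LINT y|sphere_measure. \<Phi> (x \<bullet> y) * g y) - (\<Sum>j = 1..n. w j * \<Phi> (x \<bullet> \<xi> j))\<bar>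
      \<le> 3 * \<eta> + 2 * \<sigma> * sqrt \<Lambda>" if x: "x \<in> sphere 0 1" for x
  proof -
    obtain k0 where k0: "k0 < K" "dist x (q k0) \<le> \<eta>" using cover[OF x] by blast
    define \<alpha> where "\<alpha> k = a 1 k - a (-1) k" for k
    have \<alpha>: "(\<Sum>k<K. \<bar>\<alpha> k\<bar>) \<le> 1"
    proof -
      have "(\<Sum>k<K. \<bar>\<alpha> k\<bar>) \<le> (\<Sum>k<K. a 1 k + a (-1) k)"
      proof (rule sum_mono)
        fix k show "\<bar>\<alpha> k\<bar> \<le> a 1 k + a (-1) k" using a0[of 1 k] a0[of "-1" k] by (simp add: \<alpha>_def abs_le_iff)
      qed
      then show ?thesis using mass1 by linarith
    qed
    have "\<bar>(\<Sum>k<K. (\<alpha> k - v k) * \<Phi> (x \<bullet> q k)) - (\<Sum>k<K. (\<alpha> k - v k) * \<Phi> (q k0 \<bullet> q k))\<bar>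
        = \<bar>\<Sum>k<K. (\<alpha> k - v k) * (\<Phi> (q k \<bullet> x) - \<Phi> (q k \<bullet> q k0))\<bar>"
      by (simp add: right_diff_distrib sum_subtractf inner_commute)
    also have "\<dots> \<le> (\<Sum>k<K. (\<bar>\<alpha> k\<bar> + \<bar>v k\<bar>) * \<eta>)"
    proof (rule order_trans[OF sum_abs sum_mono])
      fix k assume "k \<in> {..<K}"
      then have "\<bar>\<Phi> (q k \<bullet> x) - \<Phi> (q k \<bullet> q k0)\<bar> \<le> \<eta>"
        using \<Phi>diff[of "q k" x "q k0"] q x k0 by force
      then show "\<bar>(\<alpha> k - v k) * (\<Phi> (q k \<bullet> x) - \<Phi> (q k \<bullet> q k0))\<bar> \<le> (\<bar>\<alpha> k\<bar> + \<bar>v k\<bar>) * \<eta>"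
        unfolding abs_mult by (intro mult_mono abs_triangle_ineq4) auto
    qed
    also have "\<dots> = ((\<Sum>k<K. \<bar>\<alpha> k\<bar>) + (\<Sum>k<K. \<bar>v k\<bar>)) * \<eta>"
      by (simp add: sum_distrib_right[symmetric] sum.distrib)
    also have "\<dots> \<le> (1 + 1) * \<eta>" using \<alpha> v(2) \<eta>0 by (intro mult_right_mono add_mono) auto
    finally have "\<bar>(\<Sum>k<K. (\<alpha> k - v k) * \<Phi> (x \<bullet> q k)) - (\<Sum>k<K. (\<alpha> k - v k) * \<Phi> (q k0 \<bullet> q k))\<bar> \<le> 2 * \<eta>"
      by simp
    moreover have "\<bar>\<Sum>k<K. (\<alpha> k - v k) * \<Phi> (q k0 \<bullet> q k)\<bar> \<le> 2 * \<sigma> * sqrt \<Lambda>"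
      using v(3)[OF k0(1)] unfolding \<Psi>_def \<alpha>_def by (simp add: left_diff_distrib sum_subtractf)
    moreover have "\<bar>(LINT y|sphere_measure. \<Phi> (x \<bullet> y) * g y) - (\<Sum>k<K. \<alpha> k * \<Phi> (x \<bullet> q k))\<bar> \<le> \<eta>"
      using approx[OF x] by (simp add: \<alpha>_def)
    moreover have "(\<Sum>k<K. (\<alpha> k - v k) * \<Phi> (x \<bullet> q k))
        = (\<Sum>k<K. \<alpha> k * \<Phi> (x \<bullet> q k)) - (\<Sum>j = 1..n. w j * \<Phi> (x \<bullet> \<xi> j))"
      unfolding w[of "\<lambda>y. \<Phi> (x \<bullet> y)"] by (simp add: left_diff_distrib sum_subtractf)
    ultimately show ?thesis by linarith
  qed
  have budget: "3 * \<eta> + 2 * \<sigma> * sqrt \<Lambda> \<le> 7 * 10 ^ 6 * sqrt (real l) * real d powr (3 / 4)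
          * real N powr (- 1 / 2 - 3 / (2 * real d)) * sqrt (ln (real N))"
    using error_budget[OF assms(1) l1 assms(10)] unfolding \<eta>_def \<sigma>_def \<kappa>_def \<Lambda>_def \<rho>_def .
  have \<xi>_sphere: "\<xi> j \<in> sphere 0 1" for j using \<xi>[of j] P(3) qP by (metis subsetD)
  show ?thesis
    unfolding m_def[symmetric] n_def[symmetric]
    by (intro exI[of _ \<xi>] exI[of _ w] conjI ballI \<xi>_sphere order_trans[OF error budget])
qed

end
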